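(* Let $K$ be a compact semisimple Lie group acting in a Hamiltonian fashion on $\mathbb{CP}^n$. Then $K$ admits a Lagrangian orbit on $\mathbb{CP}^n$ if and only if the $S^1\times K$-action on $\mathbb C^{n+1}$ admits a Lagrangian orbit.
   Context: $\mathbb{CP}^n$ is regarded as the Kähler reduction of $\mathbb C^{n+1}$ (with its standard symplectic form) for the standard $S^1$-action by scalar multiplication. In the $S^1\times K$-action on $\mathbb C^{n+1}$, the factor $S^1$ acts in this standard way and $K$ acts by the Hamiltonian action on $\mathbb C^{n+1}$ that commutes with $S^1$ and induces the given $K$-action on the reduced space $\mathbb{CP}^n$. An action of a Lie group $G$ with Lie algebra $\mathfrak g$ on a symplectic manifold $(M,\omega)$ by symplectic diffeomorphisms is Hamiltonian if there is a $G$-equivariant map $\mu:M\to\mathfrak g^*$ (for the coadjoint action on $\mathfrak g^*$) such that for each $X\in\mathfrak g$ the function $\mu^X(p)=\mu(p)(X)$ satisfies $d\mu^X=i_{X^\#}\omega$, where $X^\#$ is the vector field on $M$ generated by the one-parameter subgroup $\exp(tX)$. An orbit is Lagrangian if its dimension is half the real dimension of the ambient symplectic manifold and the symplectic form vanishes on it. *)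

theory Defs
  imports "HOL-Analysis.Analysis" "HOL-Algebra.Group_Action" "HOL-Library.Function_Algebras"
begin

section \<open>Smooth manifolds\<close>

primrec Ck_on :: "nat \<Rightarrow> 'a::real_normed_vector set \<Rightarrow> ('a \<Rightarrow> 'b::real_normed_vector) \<Rightarrow> bool" where
  "Ck_on 0 W f = continuous_on W f"
| "Ck_on (Suc k) W f =
     ((\<forall>x\<in>W. f differentiable (at x)) \<and> (\<forall>v. Ck_on k W (\<lambda>x. frechet_derivative f (at x) v)))"

text \<open>On a set that need not be open, a smooth map is one that locally extends to a smooth map
  on an open set of the ambient Euclidean space.\<close>

definition smooth_on :: "'a::euclidean_space set \<Rightarrow> ('a \<Rightarrow> 'b::euclidean_space) \<Rightarrow> bool" where
  "smooth_on S f \<longleftrightarrow>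
     (\<forall>x\<in>S. \<exists>W g. open W \<and> x \<in> W \<and> (\<forall>k. Ck_on k W g) \<and> (\<forall>y\<in>W \<inter> S. g y = f y))"

text \<open>A chart is a pair of a domain and a coordinate map. Coordinates live in a relatively open
  subset of an affine subspace of a Euclidean space; this includes manifolds of dimension 0, for
  which there is no Euclidean space type. A manifold is given by its atlas; the underlying set
  and the topology are determined by it.\<close>

type_synonym ('a, 'b) atlas = "('a set \<times> ('a \<Rightarrow> 'b)) set"

definition points :: "('a, 'b) atlas \<Rightarrow> 'a set" where
  "points M = (\<Union>(U, \<phi>)\<in>M. U)"

definition atlas_topology :: "('a, 'b::euclidean_space) atlas \<Rightarrow> 'a topology" where
  "atlas_topology M =
     topology (\<lambda>T. T \<subseteq> points M \<and> (\<forall>(U, \<phi>)\<in>M. openin (top_of_set (\<phi> ` U)) (\<phi> ` (T \<inter> U))))"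

definition smooth_manifold :: "('a, 'b::euclidean_space) atlas \<Rightarrow> bool" where
  "smooth_manifold M \<longleftrightarrow>
     (\<exists>d. \<forall>(U, \<phi>)\<in>M. inj_on \<phi> U \<and>
        (\<exists>V. affine V \<and> aff_dim V = int d \<and> openin (top_of_set V) (\<phi> ` U))) \<and>
     (\<forall>(U, \<phi>)\<in>M. \<forall>(V, \<psi>)\<in>M.
        openin (top_of_set (\<phi> ` U)) (\<phi> ` (U \<inter> V)) \<and>
        smooth_on (\<phi> ` (U \<inter> V)) (\<psi> \<circ> inv_into U \<phi>)) \<and>
     Hausdorff_space (atlas_topology M) \<and> second_countable (atlas_topology M)"

definition smooth_map ::
  "('a, 'b::euclidean_space) atlas \<Rightarrow> ('c, 'd::euclidean_space) atlas \<Rightarrow> ('a \<Rightarrow> 'c) \<Rightarrow> bool" where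
  "smooth_map M N f \<longleftrightarrow>
     continuous_map (atlas_topology M) (atlas_topology N) f \<and>
     (\<forall>(U, \<phi>)\<in>M. \<forall>(V, \<psi>)\<in>N. smooth_on (\<phi> ` (U \<inter> f -` V)) (\<psi> \<circ> f \<circ> inv_into U \<phi>))"

definition euclidean_atlas :: "('a::euclidean_space, 'a) atlas" where
  "euclidean_atlas = {(UNIV, \<lambda>x. x)}"

definition prod_atlas ::
  "('a, 'b) atlas \<Rightarrow> ('c, 'd) atlas \<Rightarrow> ('a \<times> 'c, 'b \<times> 'd) atlas" where
  "prod_atlas M N = {(U \<times> V, map_prod \<phi> \<psi>) | U \<phi> V \<psi>. (U, \<phi>) \<in> M \<and> (V, \<psi>) \<in> N}"

definition smooth_functions :: "('a, 'b::euclidean_space) atlas \<Rightarrow> ('a \<Rightarrow> real) set" where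
  "smooth_functions M = {f. smooth_map M euclidean_atlas f}"


section \<open>Tangent vectors\<close>

text \<open>A tangent vector is a directional derivative acting on smooth functions, and is set to 0 on
  functions that are not smooth, so that equality of tangent vectors is equality in HOL.\<close>

type_synonym 'a functional = "('a \<Rightarrow> real) \<Rightarrow> real"

definition functional_scale :: "real \<Rightarrow> 'a functional \<Rightarrow> 'a functional" where
  "functional_scale r v = (\<lambda>f. r * v f)"

interpretation functional: vector_space functional_scale
  by unfold_locales (auto simp: functional_scale_def fun_eq_iff algebra_simps)

definition velocity :: "('a, 'b::euclidean_space) atlas \<Rightarrow> (real \<Rightarrow> 'a) \<Rightarrow> 'a functional" where
  "velocity M c = (\<lambda>f. if f \<in> smooth_functions M then deriv (f \<circ> c) 0 else 0)"

definition curves_through ::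
  "('a, 'b::euclidean_space) atlas \<Rightarrow> 'a set \<Rightarrow> 'a \<Rightarrow> (real \<Rightarrow> 'a) set" where
  "curves_through M S p =
     {c. smooth_map (euclidean_atlas :: (real, real) atlas) M c \<and> c 0 = p \<and> range c \<subseteq> S}"

text \<open>The tangent space at \<open>p\<close> of a submanifold \<open>S\<close> of \<open>M\<close>; in particular, of \<open>M\<close> itself when
  \<open>S = points M\<close>.\<close>

definition tangent_space ::
  "('a, 'b::euclidean_space) atlas \<Rightarrow> 'a set \<Rightarrow> 'a \<Rightarrow> 'a functional set" where
  "tangent_space M S p = velocity M ` curves_through M S p"

definition pushforward ::
  "('c, 'd::euclidean_space) atlas \<Rightarrow> ('a \<Rightarrow> 'c) \<Rightarrow> 'a functional \<Rightarrow> 'c functional" where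
  "pushforward N g v = (\<lambda>f. if f \<in> smooth_functions N then v (f \<circ> g) else 0)"

type_synonym 'a two_form = "'a \<Rightarrow> 'a functional \<Rightarrow> 'a functional \<Rightarrow> real"


section \<open>Lie groups\<close>

definition lie_group :: "('k, 'x) monoid_scheme \<Rightarrow> ('k, 'b::euclidean_space) atlas \<Rightarrow> bool" where
  "lie_group K A \<longleftrightarrow>
     group K \<and> smooth_manifold A \<and> points A = carrier K \<and>
     smooth_map (prod_atlas A A) A (\<lambda>(x, y). x \<otimes>\<^bsub>K\<^esub> y) \<and>
     smooth_map A A (\<lambda>x. inv\<^bsub>K\<^esub> x)"

text \<open>The Lie algebra is the tangent space at the identity; the bracket of \<open>X\<close> and \<open>Y\<close> is the
  value at the identity of the commutator of the left invariant vector fields they generate.\<close>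

definition lie_algebra ::
  "('k, 'x) monoid_scheme \<Rightarrow> ('k, 'b::euclidean_space) atlas \<Rightarrow> 'k functional set" where
  "lie_algebra K A = tangent_space A (points A) \<one>\<^bsub>K\<^esub>"

definition left_invariant_field ::
  "('k, 'x) monoid_scheme \<Rightarrow> 'k functional \<Rightarrow> ('k \<Rightarrow> real) \<Rightarrow> 'k \<Rightarrow> real" where
  "left_invariant_field K X f = (\<lambda>x. X (\<lambda>y. f (x \<otimes>\<^bsub>K\<^esub> y)))"

definition lie_bracket ::
  "('k, 'x) monoid_scheme \<Rightarrow> ('k, 'b::euclidean_space) atlas \<Rightarrow>
   'k functional \<Rightarrow> 'k functional \<Rightarrow> 'k functional" where
  "lie_bracket K A X Y =
     (\<lambda>f. if f \<in> smooth_functions A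
          then X (left_invariant_field K Y f) - Y (left_invariant_field K X f) else 0)"

definition lie_ideal ::
  "('k, 'x) monoid_scheme \<Rightarrow> ('k, 'b::euclidean_space) atlas \<Rightarrow> 'k functional set \<Rightarrow> bool" where
  "lie_ideal K A I \<longleftrightarrow>
     functional.subspace I \<and> I \<subseteq> lie_algebra K A \<and>
     (\<forall>X\<in>lie_algebra K A. \<forall>Y\<in>I. lie_bracket K A X Y \<in> I)"

definition derived_subalgebra ::
  "('k, 'x) monoid_scheme \<Rightarrow> ('k, 'b::euclidean_space) atlas \<Rightarrow>
   'k functional set \<Rightarrow> 'k functional set" where
  "derived_subalgebra K A I = functional.span {lie_bracket K A X Y | X Y. X \<in> I \<and> Y \<in> I}"

definition lie_solvable ::
  "('k, 'x) monoid_scheme \<Rightarrow> ('k, 'b::euclidean_space) atlas \<Rightarrow> 'k functional set \<Rightarrow> bool" where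
  "lie_solvable K A I \<longleftrightarrow> (\<exists>m. (derived_subalgebra K A ^^ m) I = {0})"

definition semisimple_lie_group ::
  "('k, 'x) monoid_scheme \<Rightarrow> ('k, 'b::euclidean_space) atlas \<Rightarrow> bool" where
  "semisimple_lie_group K A \<longleftrightarrow>
     lie_group K A \<and> (\<forall>I. lie_ideal K A I \<and> lie_solvable K A I \<longrightarrow> I = {0})"

definition lie_exp ::
  "('k, 'x) monoid_scheme \<Rightarrow> ('k, 'b::euclidean_space) atlas \<Rightarrow> 'k functional \<Rightarrow> 'k" where
  "lie_exp K A X =
     (THE \<gamma>. smooth_map (euclidean_atlas :: (real, real) atlas) A \<gamma> \<and>
             (\<forall>s t. \<gamma> (s + t) = \<gamma> s \<otimes>\<^bsub>K\<^esub> \<gamma> t) \<and> velocity A \<gamma> = X) 1"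

definition Ad ::
  "('k, 'x) monoid_scheme \<Rightarrow> ('k, 'b::euclidean_space) atlas \<Rightarrow>
   'k \<Rightarrow> 'k functional \<Rightarrow> 'k functional" where
  "Ad K A k X = pushforward A (\<lambda>x. k \<otimes>\<^bsub>K\<^esub> x \<otimes>\<^bsub>K\<^esub> inv\<^bsub>K\<^esub> k) X"


section \<open>Hamiltonian actions and Lagrangian orbits\<close>

definition symplectic_diffeo ::
  "('m, 'c::euclidean_space) atlas \<Rightarrow> 'm two_form \<Rightarrow> ('m \<Rightarrow> 'm) \<Rightarrow> bool" where
  "symplectic_diffeo M \<omega> g \<longleftrightarrow>
     bij_betw g (points M) (points M) \<and> smooth_map M M g \<and>
     smooth_map M M (inv_into (points M) g) \<and>
     (\<forall>p\<in>points M. \<forall>v\<in>tangent_space M (points M) p. \<forall>w\<in>tangent_space M (points M) p.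
        \<omega> (g p) (pushforward M g v) (pushforward M g w) = \<omega> p v w)"

definition fundamental_field ::
  "('k, 'x) monoid_scheme \<Rightarrow> ('k, 'b::euclidean_space) atlas \<Rightarrow> ('m, 'c::euclidean_space) atlas \<Rightarrow>
   ('k \<Rightarrow> 'm \<Rightarrow> 'm) \<Rightarrow> 'k functional \<Rightarrow> 'm \<Rightarrow> 'm functional" where
  "fundamental_field K A M \<phi> X p =
     velocity M (\<lambda>t. \<phi> (lie_exp K A (functional_scale t X)) p)"

text \<open>In \<open>moment_map\<close>, the covector \<open>\<mu> p\<close> is a function that is linear on the Lie algebra; its
  values elsewhere are irrelevant. The differential of a function \<open>h\<close> applied to a tangent vector
  \<open>v\<close> is \<open>v h\<close>.\<close>

definition moment_map ::
  "('k, 'x) monoid_scheme \<Rightarrow> ('k, 'b::euclidean_space) atlas \<Rightarrow> ('m, 'c::euclidean_space) atlas \<Rightarrow>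
   'm two_form \<Rightarrow> ('k \<Rightarrow> 'm \<Rightarrow> 'm) \<Rightarrow> ('m \<Rightarrow> 'k functional \<Rightarrow> real) \<Rightarrow> bool" where
  "moment_map K A M \<omega> \<phi> \<mu> \<longleftrightarrow>
     (\<forall>p\<in>points M. \<forall>X\<in>lie_algebra K A. \<forall>Y\<in>lie_algebra K A. \<forall>a b.
        \<mu> p (functional_scale a X + functional_scale b Y) = a * \<mu> p X + b * \<mu> p Y) \<and>
     (\<forall>k\<in>carrier K. \<forall>p\<in>points M. \<forall>X\<in>lie_algebra K A.
        \<mu> (\<phi> k p) X = \<mu> p (Ad K A (inv\<^bsub>K\<^esub> k) X)) \<and>
     (\<forall>X\<in>lie_algebra K A. (\<lambda>p. \<mu> p X) \<in> smooth_functions M \<and>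
        (\<forall>p\<in>points M. \<forall>v\<in>tangent_space M (points M) p.
           v (\<lambda>p. \<mu> p X) = \<omega> p (fundamental_field K A M \<phi> X p) v))"

definition hamiltonian_action ::
  "('k, 'x) monoid_scheme \<Rightarrow> ('k, 'b::euclidean_space) atlas \<Rightarrow> ('m, 'c::euclidean_space) atlas \<Rightarrow>
   'm two_form \<Rightarrow> ('k \<Rightarrow> 'm \<Rightarrow> 'm) \<Rightarrow> bool" where
  "hamiltonian_action K A M \<omega> \<phi> \<longleftrightarrow>
     group_action K (points M) \<phi> \<and>
     smooth_map (prod_atlas A M) M (\<lambda>(k, p). \<phi> k p) \<and>
     (\<forall>k\<in>carrier K. symplectic_diffeo M \<omega> (\<phi> k)) \<and>
     (\<exists>\<mu>. moment_map K A M \<omega> \<phi> \<mu>)"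

definition lagrangian ::
  "('m, 'c::euclidean_space) atlas \<Rightarrow> 'm two_form \<Rightarrow> 'm set \<Rightarrow> bool" where
  "lagrangian M \<omega> S \<longleftrightarrow>
     (\<forall>p\<in>S. 2 * functional.dim (tangent_space M S p) =
              functional.dim (tangent_space M (points M) p) \<and>
            (\<forall>v\<in>tangent_space M S p. \<forall>w\<in>tangent_space M S p. \<omega> p v w = 0))"


section \<open>Complex space and complex projective space\<close>

text \<open>The form \<open>\<Sum>j. dx\<^sub>j \<and> dy\<^sub>j\<close>, where \<open>z\<^sub>j = x\<^sub>j + i y\<^sub>j\<close>.\<close>

definition std_form :: "(complex ^ 'n) two_form" where
  "std_form p v w =
     (\<Sum>j\<in>UNIV. v (\<lambda>z. Re (z $ j)) * w (\<lambda>z. Im (z $ j)) - v (\<lambda>z. Im (z $ j)) * w (\<lambda>z. Re (z $ j)))"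

text \<open>Points of the projective space are complex lines in \<open>complex ^ 'n\<close>, so its complex dimension is
  \<open>CARD('n) - 1\<close>. The \<open>i\<close>-th affine chart sends a line to its point whose \<open>i\<close>-th coordinate
  is 1.\<close>

definition line :: "complex ^ 'n \<Rightarrow> (complex ^ 'n) set" where
  "line z = range (\<lambda>c. c *s z)"

definition proj_atlas :: "((complex ^ 'n) set, complex ^ 'n) atlas" where
  "proj_atlas = {({line z | z. z $ i \<noteq> 0}, \<lambda>L. THE w. w \<in> L \<and> w $ i = 1) | i. True}"

text \<open>The symplectic form of the reduction of \<open>complex ^ 'n\<close> at the unit sphere, a level set of the
  moment map of the circle action: its pullback to the sphere along \<open>line\<close> is the restriction of
  the standard form.\<close>

definition reduced_form :: "((complex ^ 'n) set) two_form" where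
  "reduced_form L v w =
     (THE r. \<exists>z c d. c \<in> curves_through euclidean_atlas (sphere 0 1) z \<and>
                     d \<in> curves_through euclidean_atlas (sphere 0 1) z \<and> line z = L \<and>
                     velocity proj_atlas (line \<circ> c) = v \<and> velocity proj_atlas (line \<circ> d) = w \<and>
                     r = std_form z (velocity euclidean_atlas c) (velocity euclidean_atlas d))"

definition circle_group :: "complex monoid" where
  "circle_group = \<lparr>carrier = sphere 0 1, mult = (*), one = 1\<rparr>"

text \<open>An action \<open>\<Phi>\<close> on \<open>complex ^ 'n\<close> is a lift of an action \<open>\<phi>\<close> on the projective space if it
  commutes with the circle action and induces \<open>\<phi>\<close> on the quotient of the nonzero vectors. That is,
  it induces \<open>\<phi>\<close> on the reduced space at every positive level, each of which is canonically
  the space of lines.\<close>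

definition lifts_projective_action ::
  "('k, 'x) monoid_scheme \<Rightarrow> ('k \<Rightarrow> (complex ^ 'n) set \<Rightarrow> (complex ^ 'n) set) \<Rightarrow>
   ('k \<Rightarrow> complex ^ 'n \<Rightarrow> complex ^ 'n) \<Rightarrow> bool" where
  "lifts_projective_action K \<phi> \<Phi> \<longleftrightarrow>
     (\<forall>k\<in>carrier K. \<forall>u\<in>carrier circle_group. \<forall>z. \<Phi> k (u *s z) = u *s \<Phi> k z) \<and>
     (\<forall>k\<in>carrier K. \<forall>z. z \<noteq> 0 \<longrightarrow> line (\<Phi> k z) = \<phi> k (line z))"

definition circle_product_action ::
  "('k \<Rightarrow> complex ^ 'n \<Rightarrow> complex ^ 'n) \<Rightarrow> complex \<times> 'k \<Rightarrow> complex ^ 'n \<Rightarrow> complex ^ 'n" where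
  "circle_product_action \<Phi> = (\<lambda>(u, k) z. u *s \<Phi> k z)"

end

theory Submission
  imports Defs
begin

text \<open>A map of \<open>complex ^ 'n\<close> that is symplectic and commutes with the circle preserves the norm, because
  the squared norm is determined up to a constant by the symplectic form and the generator of the
  circle action. So the orbit of \<open>z \<noteq> 0\<close> under the product group is the full preimage, in the sphere
  through \<open>z\<close>, of the orbit of \<open>line z\<close>. For an arbitrary set \<open>S\<close> of lines, curves in \<open>S\<close> lift to the
  preimage \<open>T\<close> of \<open>S\<close> in the unit sphere, so the tangent vectors of \<open>S\<close> are the projections of those
  of \<open>T\<close>. On the sphere the kernel of the projection is spanned by \<open>\<i> *s z\<close>, which is tangent to \<open>T\<close> and
  orthogonal to the sphere for the symplectic form. Hence passing from \<open>S\<close> to \<open>T\<close> raises the dimension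
  by one and preserves isotropy, while the ambient dimension rises by two.\<close>

section \<open>Calculus of continuously differentiable maps\<close>

text \<open>A tangent vector here is an operator on globally smooth functions, and a tangent space
  is a bare set of velocities of curves defined for all real times. Both conventions shape the
  proof. Velocities are encoded by vectors: \<open>directional p\<close> embeds the vectors at a
  point of Euclidean space, and \<open>projected z\<close> sends vectors at a unit vector z to
  tangent vectors at \<open>line z\<close>. The sets of velocities carry no subspace structure, so
  dimensions are those of spans and the kernel of \<open>projected z\<close> is split off from a
  basis. That kernel has to be found by testing on functions smooth on the whole projective space,
  where chart coordinates are in general not defined; entries of the orthogonal projection onto a
  line take their place. The origin needs separate treatment, since it determines no point of the
  projective space.\<close>

lemma Ck_on_subset: "Ck_on k W f \<Longrightarrow> W' \<subseteq> W \<Longrightarrow> Ck_on k W' f"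
  by (induction k arbitrary: f) (auto intro: continuous_on_subset)

text \<open>A Frechet derivative depends on the germ of the function, so values on W determine it at
  points of W because W is open.\<close>

lemma Ck_on_cong:
  assumes "open W" "\<And>x. x \<in> W \<Longrightarrow> f x = g x" "Ck_on k W f"
  shows "Ck_on k W g"
  using assms(2,3)
proof (induction k arbitrary: f g)
  case 0
  then show ?case by (simp cong: continuous_on_cong)
next
  case (Suc k)
  have D: "(g has_derivative frechet_derivative f (at x)) (at x)" if "x \<in> W" for x
    using Suc.prems(2) that frechet_derivative_works[of f "at x"]
    by (intro has_derivative_transform_within_open[OF _ assms(1) that Suc.prems(1)]) auto
  have E: "frechet_derivative g (at x) = frechet_derivative f (at x)" if "x \<in> W" for x
    using frechet_derivative_at[OF D[OF that]] by simp
  have "Ck_on k W (\<lambda>x. frechet_derivative g (at x) v)" for v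
    using Suc.IH[of "\<lambda>x. frechet_derivative f (at x) v"] Suc.prems(2) E by simp
  then show ?case using D by (auto simp: differentiable_def)
qed

text \<open>\<open>frechet_derivative\<close> is a choice operator; by uniqueness of derivatives an
  explicit formula may replace it. Most inductions on k below take their step through this
  rule.\<close>

lemma Ck_on_SucI:
  assumes "open W" "\<And>x. x \<in> W \<Longrightarrow> (f has_derivative f' x) (at x)"
    "\<And>v. Ck_on k W (\<lambda>x. f' x v)"
  shows "Ck_on (Suc k) W f"
proof -
  have "f' x = frechet_derivative f (at x)" if "x \<in> W" for x
    using frechet_derivative_at assms(2)[OF that] by blast
  then have "Ck_on k W (\<lambda>x. frechet_derivative f (at x) v)" for v
    by (intro Ck_on_cong[OF assms(1) _ assms(3)[of v]]) simp
  then show ?thesis using assms(2) by (auto simp: differentiable_def)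
qed

lemma Ck_on_SucD: "Ck_on (Suc k) W f \<Longrightarrow> Ck_on k W f"
proof (induction k arbitrary: f)
  case 0
  then show ?case
    by (auto simp: continuous_on_eq_continuous_within
        intro: differentiable_imp_continuous_within differentiable_at_withinI)
qed auto

lemma Ck_on_has_derivative:
  "Ck_on (Suc k) W f \<Longrightarrow> x \<in> W \<Longrightarrow> (f has_derivative frechet_derivative f (at x)) (at x)"
  using frechet_derivative_works by auto

text \<open>Continuity and derivatives are local on an open set. This glues the local extensions
  that occur in \<open>smooth_on\<close>.\<close>

lemma Ck_on_local:
  assumes "\<And>x. x \<in> S \<Longrightarrow> \<exists>W. open W \<and> x \<in> W \<and> Ck_on k (W \<inter> S) f" "open S"
  shows "Ck_on k S f"
  using assms(1)
proof (induction k arbitrary: f)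
  case 0
  have "continuous (at x) f" if x: "x \<in> S" for x
  proof -
    from 0[OF x] obtain W where W: "open W" "x \<in> W" "continuous_on (W \<inter> S) f" by auto
    have "open (W \<inter> S)" using W(1) assms(2) by (rule open_Int)
    then show ?thesis
      using W x by (simp add: continuous_on_eq_continuous_at)
  qed
  then show ?case by (simp add: continuous_at_imp_continuous_on)
next
  case (Suc k)
  have "f differentiable (at x)" if "x \<in> S" for x
    using Suc.prems[OF that] that by auto
  moreover have "Ck_on k S (\<lambda>x. frechet_derivative f (at x) v)" for v
    using Suc.prems by (intro Suc.IH) (metis Ck_on.simps(2))
  ultimately show ?case by simp
qed

lemma Ck_on_const: "Ck_on k W (\<lambda>x. c)"
  by (induction k arbitrary: c) auto

lemma Ck_on_bounded_linear: "bounded_linear h \<Longrightarrow> Ck_on k W h"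
proof (induction k)
  case 0
  then show ?case
    by (simp add: linear_continuous_on)
next
  case (Suc k)
  have "Ck_on (Suc k) UNIV h"
    by (rule Ck_on_SucI[where f' = "\<lambda>x. h"])
      (auto intro: Ck_on_const bounded_linear_imp_has_derivative Suc.prems)
  then show ?case by (rule Ck_on_subset) simp
qed

lemma Ck_on_linear_compose:
  assumes "open W" "bounded_linear h" "Ck_on k W f"
  shows "Ck_on k W (\<lambda>x. h (f x))"
  using assms(3)
proof (induction k arbitrary: f)
  case 0
  then show ?case using assms(2)
    by (auto intro: bounded_linear.continuous_on)
next
  case (Suc k)
  show ?case
    by (rule Ck_on_SucI[OF assms(1), where f' = "\<lambda>x v. h (frechet_derivative f (at x) v)"])
      (use Suc in \<open>auto intro!: bounded_linear.has_derivative[OF assms(2)] Ck_on_has_derivative\<close>)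
qed

lemma Ck_on_add:
  assumes "open W" "Ck_on k W f" "Ck_on k W g"
  shows "Ck_on k W (\<lambda>x. f x + g x)"
  using assms(2,3)
proof (induction k arbitrary: f g)
  case 0
  then show ?case by (auto intro: continuous_intros)
next
  case (Suc k)
  show ?case
    by (rule Ck_on_SucI[OF assms(1),
        where f' = "\<lambda>x v. frechet_derivative f (at x) v + frechet_derivative g (at x) v"])
      (use Suc in \<open>auto intro!: has_derivative_add Ck_on_has_derivative\<close>)
qed

lemma Ck_on_sum:
  assumes "open W" "\<And>i. i \<in> I \<Longrightarrow> Ck_on k W (f i)"
  shows "Ck_on k W (\<lambda>x. \<Sum>i\<in>I. f i x)"
  using assms(2)
  by (induction I rule: infinite_finite_induct) (auto intro: Ck_on_const Ck_on_add assms(1))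

lemma Ck_on_bilinear:
  assumes "open W" "bounded_bilinear h" "Ck_on k W f" "Ck_on k W g"
  shows "Ck_on k W (\<lambda>x. h (f x) (g x))"
  using assms(3,4)
proof (induction k arbitrary: f g)
  case 0
  then show ?case using bounded_bilinear.continuous_on[OF assms(2)] by simp
next
  case (Suc k)
  note D = Suc.prems[THEN Ck_on_SucD]
  show ?case
    by (rule Ck_on_SucI[OF assms(1), where f' = "\<lambda>x v.
        h (f x) (frechet_derivative g (at x) v) + h (frechet_derivative f (at x) v) (g x)"])
      (use Suc.prems D in \<open>auto intro!: Ck_on_add assms(1) Suc.IH
        bounded_bilinear.FDERIV[OF assms(2)] Ck_on_has_derivative\<close>)
qed

text \<open>In the chain rule the direction in which g is differentiated varies with x, while
  \<open>Ck_on\<close> controls derivatives in fixed directions. Expanding that direction in the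
  basis separates the two dependences; this is why the middle space is Euclidean.\<close>

lemma Ck_on_compose:
  fixes f :: "'a::real_normed_vector \<Rightarrow> 'b::euclidean_space"
  assumes "open W" "open V" "f ` W \<subseteq> V" "Ck_on k W f" "Ck_on k V g"
  shows "Ck_on k W (\<lambda>x. g (f x))"
  using assms(4,5)
proof (induction k arbitrary: g)
  case 0
  then show ?case
    using continuous_on_compose2[OF _ _ assms(3)] by simp
next
  case (Suc k)
  let ?f' = "\<lambda>x. frechet_derivative f (at x)" and ?g' = "\<lambda>y. frechet_derivative g (at y)"
  have f: "(f has_derivative ?f' x) (at x)" if "x \<in> W" for x
    using Ck_on_has_derivative Suc.prems(1) that by blast
  have g: "(g has_derivative ?g' (f x)) (at (f x))" if "x \<in> W" for x
    using Ck_on_has_derivative[OF Suc.prems(2)] assms(3) that by blast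
  show ?case
  proof (rule Ck_on_SucI[OF assms(1), where f' = "\<lambda>x v. \<Sum>i\<in>Basis. (?f' x v \<bullet> i) *\<^sub>R ?g' (f x) i"])
    fix x assume x: "x \<in> W"
    have "?g' (f x) (?f' x v) = (\<Sum>i\<in>Basis. (?f' x v \<bullet> i) *\<^sub>R ?g' (f x) i)" for v
    proof -
      interpret linear "?g' (f x)" using has_derivative_linear[OF g[OF x]] .
      have "?g' (f x) (\<Sum>i\<in>Basis. (?f' x v \<bullet> i) *\<^sub>R i) = (\<Sum>i\<in>Basis. (?f' x v \<bullet> i) *\<^sub>R ?g' (f x) i)"
        by (simp add: sum scaleR)
      then show ?thesis by (simp add: euclidean_representation)
    qed
    then show "((\<lambda>x. g (f x)) has_derivative
        (\<lambda>v. \<Sum>i\<in>Basis. (?f' x v \<bullet> i) *\<^sub>R ?g' (f x) i)) (at x)"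
      using has_derivative_compose[OF f[OF x] g[OF x]] by simp
  next
    fix v
    have "Ck_on k W (\<lambda>x. ?g' (f x) i)" for i
      using Suc.IH[OF Ck_on_SucD[OF Suc.prems(1)], of "\<lambda>y. ?g' y i"] Suc.prems(2) by simp
    moreover have "Ck_on k W (\<lambda>x. ?f' x v \<bullet> i)" for i
      using Suc.prems by (intro Ck_on_linear_compose[OF assms(1) bounded_linear_inner_left]) auto
    ultimately show "Ck_on k W (\<lambda>x. \<Sum>i\<in>Basis. (?f' x v \<bullet> i) *\<^sub>R ?g' (f x) i)"
      by (intro Ck_on_sum Ck_on_bilinear[OF _ bounded_bilinear_scaleR] assms(1))
  qed
qed

text \<open>Openness is part of the notion, so that the rules for sums, products and compositions
  carry no side condition on the domain.\<close>

definition smooth :: "'a::euclidean_space set \<Rightarrow> ('a \<Rightarrow> 'b::euclidean_space) \<Rightarrow> bool" where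
  "smooth W f \<longleftrightarrow> open W \<and> (\<forall>k. Ck_on k W f)"

lemma smooth_open: "smooth W f \<Longrightarrow> open W"
  by (simp add: smooth_def)

lemma smooth_subset: "smooth W f \<Longrightarrow> open W' \<Longrightarrow> W' \<subseteq> W \<Longrightarrow> smooth W' f"
  unfolding smooth_def using Ck_on_subset by blast

lemma smooth_cong: "smooth W f \<Longrightarrow> (\<And>x. x \<in> W \<Longrightarrow> f x = g x) \<Longrightarrow> smooth W g"
  unfolding smooth_def using Ck_on_cong by blast

lemma smooth_const: "open W \<Longrightarrow> smooth W (\<lambda>x. c)"
  by (simp add: smooth_def Ck_on_const)

lemma smooth_bounded_linear: "open W \<Longrightarrow> bounded_linear h \<Longrightarrow> smooth W h"
  by (simp add: smooth_def Ck_on_bounded_linear)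

lemma smooth_id: "open W \<Longrightarrow> smooth W (\<lambda>x. x)"
  by (simp add: smooth_bounded_linear)

lemma smooth_linear_compose: "bounded_linear h \<Longrightarrow> smooth W f \<Longrightarrow> smooth W (\<lambda>x. h (f x))"
  by (simp add: smooth_def Ck_on_linear_compose)

lemma smooth_add: "smooth W f \<Longrightarrow> smooth W g \<Longrightarrow> smooth W (\<lambda>x. f x + g x)"
  by (simp add: smooth_def Ck_on_add)

lemma smooth_bilinear:
  "bounded_bilinear h \<Longrightarrow> smooth W f \<Longrightarrow> smooth W g \<Longrightarrow> smooth W (\<lambda>x. h (f x) (g x))"
  by (simp add: smooth_def Ck_on_bilinear)

lemmas smooth_scaleR = smooth_bilinear[OF bounded_bilinear_scaleR]

lemma smooth_compose:
  "smooth W f \<Longrightarrow> smooth V g \<Longrightarrow> f ` W \<subseteq> V \<Longrightarrow> smooth W (\<lambda>x. g (f x))"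
  unfolding smooth_def using Ck_on_compose by blast

lemma smooth_has_derivative:
  "smooth W f \<Longrightarrow> x \<in> W \<Longrightarrow> (f has_derivative frechet_derivative f (at x)) (at x)"
  unfolding smooth_def using Ck_on_has_derivative by blast

lemma smooth_continuous_on: "smooth W f \<Longrightarrow> continuous_on W f"
  unfolding smooth_def using Ck_on.simps(1) by blast

lemma smooth_has_vector_derivative:
  "smooth W c \<Longrightarrow> t \<in> W \<Longrightarrow> (c has_vector_derivative vector_derivative c (at t)) (at t)"
  using smooth_has_derivative[of W c t] vector_derivative_works
  by (auto simp: differentiable_def)

lemma smooth_onI:
  "smooth W g \<Longrightarrow> S \<subseteq> W \<Longrightarrow> (\<And>y. y \<in> S \<Longrightarrow> g y = f y) \<Longrightarrow> smooth_on S f"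
  unfolding smooth_on_def smooth_def by blast

lemma smooth_on_eq_smooth:
  assumes "open S"
  shows "smooth_on S f \<longleftrightarrow> smooth S f"
proof
  assume L: "smooth_on S f"
  have "Ck_on k S f" for k
  proof (rule Ck_on_local[OF _ assms])
    fix x assume "x \<in> S"
    then obtain W g where W: "open W" "x \<in> W" "Ck_on k W g" "\<forall>y\<in>W \<inter> S. g y = f y"
      using L unfolding smooth_on_def by blast
    then have "Ck_on k (W \<inter> S) f"
      using assms by (intro Ck_on_cong[OF open_Int _ Ck_on_subset[of k W g]]) auto
    then show "\<exists>W. open W \<and> x \<in> W \<and> Ck_on k (W \<inter> S) f" using W by blast
  qed
  then show "smooth S f" using assms by (simp add: smooth_def)
qed (simp add: smooth_onI)

section \<open>Smoothness of inverse, square root, circle parametrization and norm\<close>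

lemma open_nonzero [simp]: "open (- {0 :: 'a::{zero, t1_space}})"
  by (rule open_Compl) simp

text \<open>The derivative is again a product of inverses and the direction v, so the induction on k
  closes. One type class covers the real and the complex case.\<close>

lemma smooth_inverse: "smooth (- {0}) (inverse :: 'a::{euclidean_space, real_normed_field} \<Rightarrow> 'a)"
proof -
  have "Ck_on k (- {0}) (inverse :: 'a \<Rightarrow> 'a)" for k
  proof (induction k)
    case 0
    then show ?case by (auto intro: continuous_intros)
  next
    case (Suc k)
    show ?case
    proof (rule Ck_on_SucI[where f' = "\<lambda>x v. - (inverse x * (v * inverse x))"])
      show "(inverse has_derivative (\<lambda>v. - (inverse x * (v * inverse x)))) (at x)"
        if "x \<in> - {0}" for x :: 'a
        using has_derivative_inverse'[of x UNIV] that by (simp add: mult.assoc)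
    next
      fix v :: 'a
      have "Ck_on k (- {0}) (\<lambda>x. v * inverse x)"
        by (intro Ck_on_linear_compose[OF _ bounded_linear_mult_right] Suc) simp
      then have "Ck_on k (- {0}) (\<lambda>x. inverse x * (v * inverse x))"
        by (rule Ck_on_bilinear[OF open_nonzero bounded_bilinear_mult Suc])
      then show "Ck_on k (- {0}) (\<lambda>x. - (inverse x * (v * inverse x)))"
        by (rule Ck_on_linear_compose[OF open_nonzero bounded_linear_minus[OF bounded_linear_ident]])
    qed simp
  qed
  then show ?thesis by (simp add: smooth_def)
qed

lemma smooth_inverse_compose:
  fixes f :: "'a::euclidean_space \<Rightarrow> 'b::{euclidean_space, real_normed_field}"
  shows "smooth W f \<Longrightarrow> (\<And>x. x \<in> W \<Longrightarrow> f x \<noteq> 0) \<Longrightarrow> smooth W (\<lambda>x. inverse (f x))"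
  by (rule smooth_compose[OF _ smooth_inverse]) auto

text \<open>The derivative of the root is half the inverse of the root, so the induction step needs
  only the root at level k and smoothness of the inverse.\<close>

lemma smooth_sqrt: "smooth {0<..} sqrt"
proof -
  have "Ck_on k {0<..} sqrt" for k
  proof (induction k)
    case 0
    then show ?case by (simp add: continuous_on_real_sqrt)
  next
    case (Suc k)
    show ?case
    proof (rule Ck_on_SucI[where f' = "\<lambda>x v. inverse (sqrt x) * (v / 2)"])
      fix v
      have "Ck_on k {0<..} (\<lambda>x. inverse (sqrt x))"
        by (rule Ck_on_compose[OF _ open_nonzero _ Suc
              smooth_inverse[unfolded smooth_def, THEN conjunct2, rule_format]])
          auto
      then show "Ck_on k {0<..} (\<lambda>x. inverse (sqrt x) * (v / 2))"
        by (intro Ck_on_linear_compose[OF _ bounded_linear_mult_left]) simp_all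
    next
      fix x :: real assume "x \<in> {0<..}"
      then have "(sqrt has_derivative (*) (inverse (sqrt x) / 2)) (at x)"
        using DERIV_real_sqrt[of x] by (simp add: has_field_derivative_def)
      then show "(sqrt has_derivative (\<lambda>v. inverse (sqrt x) * (v / 2))) (at x)"
        by (rule has_derivative_eq_rhs) (simp add: fun_eq_iff)
    qed simp
  qed
  then show ?thesis by (simp add: smooth_def)
qed

lemma smooth_cis: "smooth UNIV cis"
proof -
  have "Ck_on k UNIV cis" for k
  proof (induction k)
    case 0
    then show ?case by (simp add: continuous_on_cis)
  next
    case (Suc k)
    show ?case
    proof (rule Ck_on_SucI[where f' = "\<lambda>x v. v *\<^sub>R (\<i> * cis x)"])
      show "Ck_on k UNIV (\<lambda>x. v *\<^sub>R (\<i> * cis x))" for v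
        using bounded_linear_compose[OF bounded_linear_scaleR_right bounded_linear_mult_right]
        by (rule Ck_on_linear_compose[OF open_UNIV _ Suc])
    next
      show "(cis has_derivative (\<lambda>v. v *\<^sub>R (\<i> * cis x))) (at x)" for x
        using has_derivative_cis[OF has_derivative_ident, of x UNIV] by simp
    qed simp
  qed
  then show ?thesis by (simp add: smooth_def)
qed

lemma smooth_sin: "smooth UNIV (sin :: real \<Rightarrow> real)"
  using smooth_linear_compose[OF bounded_linear_Im smooth_cis] by simp

lemma smooth_norm: "smooth (- {0}) (norm :: 'a::euclidean_space \<Rightarrow> real)"
proof -
  have "smooth (- {0}) (\<lambda>x::'a. x \<bullet> x)"
    by (intro smooth_bilinear[OF bounded_bilinear_inner] smooth_id) simp_all
  then have "smooth (- {0}) (\<lambda>x::'a. sqrt (x \<bullet> x))"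
    by (rule smooth_compose[OF _ smooth_sqrt]) auto
  then show ?thesis by (simp add: norm_eq_sqrt_inner[abs_def])
qed

lemma smooth_normalize:
  "smooth W f \<Longrightarrow> (\<And>x. x \<in> W \<Longrightarrow> f x \<noteq> 0) \<Longrightarrow> smooth W (\<lambda>x. inverse (norm (f x)) *\<^sub>R f x)"
  by (intro smooth_scaleR smooth_inverse_compose smooth_compose[OF _ smooth_norm]) auto

section \<open>Euclidean space as a manifold\<close>

text \<open>Injective charts commute with intersections, which makes the predicate in
  \<open>atlas_topology\<close> a topology; without that the constructor \<open>topology\<close>
  says nothing about the open sets.\<close>

lemma openin_atlas_topology:
  assumes "\<And>U \<phi>. (U, \<phi>) \<in> M \<Longrightarrow> inj_on \<phi> U"
  shows "openin (atlas_topology M) T \<longleftrightarrow>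
    T \<subseteq> points M \<and> (\<forall>(U, \<phi>)\<in>M. openin (top_of_set (\<phi> ` U)) (\<phi> ` (T \<inter> U)))"
proof -
  let ?P = "\<lambda>T. T \<subseteq> points M \<and> (\<forall>(U, \<phi>)\<in>M. openin (top_of_set (\<phi> ` U)) (\<phi> ` (T \<inter> U)))"
  have "istopology ?P"
    unfolding istopology_def
  proof (rule conjI; intro allI impI)
    fix S T assume S: "?P S" and T: "?P T"
    have "openin (top_of_set (\<phi> ` U)) (\<phi> ` (S \<inter> T \<inter> U))" if "(U, \<phi>) \<in> M" for U \<phi>
    proof -
      have "\<phi> ` (S \<inter> T \<inter> U) = \<phi> ` (S \<inter> U) \<inter> \<phi> ` (T \<inter> U)"
        using assms[OF that] by (auto simp: inj_on_def)
      then show ?thesis using S T that by (auto intro!: openin_Int)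
    qed
    then show "?P (S \<inter> T)" using S by blast
  next
    fix \<K> assume K: "\<forall>S\<in>\<K>. ?P S"
    have "openin (top_of_set (\<phi> ` U)) (\<phi> ` (\<Union>\<K> \<inter> U))" if "(U, \<phi>) \<in> M" for U \<phi>
    proof -
      have "\<phi> ` (\<Union>\<K> \<inter> U) = (\<Union>S\<in>\<K>. \<phi> ` (S \<inter> U))" by auto
      then show ?thesis using K that by (auto intro!: openin_Union)
    qed
    then show "?P (\<Union>\<K>)" using K by blast
  qed
  then show ?thesis by (simp add: atlas_topology_def topology_inverse')
qed

lemma topspace_atlas_topology:
  assumes "\<And>U \<phi>. (U, \<phi>) \<in> M \<Longrightarrow> inj_on \<phi> U"
  shows "topspace (atlas_topology M) = points M"
proof -
  have "openin (top_of_set (\<phi> ` U)) (\<phi> ` (points M \<inter> U))" if "(U, \<phi>) \<in> M" for U \<phi>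
  proof -
    have "points M \<inter> U = U" using that by (auto simp: points_def)
    then show ?thesis by simp
  qed
  then have "openin (atlas_topology M) (points M)"
    using openin_atlas_topology[OF assms, where T = "points M"] by blast
  then show ?thesis
    unfolding topspace_def using openin_atlas_topology[OF assms] by blast
qed

lemma points_euclidean_atlas [simp]: "points euclidean_atlas = UNIV"
  by (simp add: points_def euclidean_atlas_def)

lemma atlas_topology_euclidean_atlas [simp]: "atlas_topology euclidean_atlas = euclidean"
proof -
  have "inj_on \<phi> U" if "(U, \<phi>) \<in> euclidean_atlas" for U and \<phi> :: "'a \<Rightarrow> 'a"
    using that by (simp add: euclidean_atlas_def)
  from openin_atlas_topology[OF this] show ?thesis
    by (simp add: topology_eq) (simp add: euclidean_atlas_def)
qed

lemma inv_into_UNIV_ident [simp]: "inv_into UNIV (\<lambda>x. x) = (\<lambda>x. x)"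
  by (simp add: fun_eq_iff inv_f_eq)

lemma smooth_map_euclidean_iff:
  "smooth_map euclidean_atlas euclidean_atlas f \<longleftrightarrow> smooth UNIV f"
  unfolding smooth_map_def atlas_topology_euclidean_atlas
  by (auto simp: euclidean_atlas_def smooth_on_eq_smooth o_def intro: smooth_continuous_on)

lemma smooth_functions_euclidean_iff:
  "f \<in> smooth_functions euclidean_atlas \<longleftrightarrow> smooth UNIV f"
  by (simp add: smooth_functions_def smooth_map_euclidean_iff)

lemma curves_through_euclidean_iff:
  "c \<in> curves_through euclidean_atlas S p \<longleftrightarrow> smooth UNIV c \<and> c 0 = p \<and> range c \<subseteq> S"
  by (simp add: curves_through_def smooth_map_euclidean_iff)

text \<open>The tangent vector at \<open>p\<close> of Euclidean space that corresponds to the vector \<open>a\<close>.\<close>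

definition directional :: "'a::euclidean_space \<Rightarrow> 'a \<Rightarrow> 'a functional" where
  "directional p a =
     (\<lambda>f. if f \<in> smooth_functions euclidean_atlas then frechet_derivative f (at p) a else 0)"

text \<open>For general S this is only a set of vectors; its \<open>dim\<close> is the dimension of
  its span, in agreement with the use of \<open>functional.dim\<close> in
  \<open>lagrangian\<close>.\<close>

definition tangent_vectors :: "'a::euclidean_space set \<Rightarrow> 'a \<Rightarrow> 'a set" where
  "tangent_vectors S p = (\<lambda>c. vector_derivative c (at 0)) ` curves_through euclidean_atlas S p"

lemma deriv_compose_curve:
  fixes c :: "real \<Rightarrow> 'a::euclidean_space" and f :: "'a \<Rightarrow> real"
  assumes "(c has_vector_derivative a) (at t)" "smooth W f" "c t \<in> W"
  shows "deriv (f \<circ> c) t = frechet_derivative f (at (c t)) a"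
    and "((f \<circ> c) has_field_derivative frechet_derivative f (at (c t)) a) (at t)"
proof -
  interpret linear "frechet_derivative f (at (c t))"
    using has_derivative_linear[OF smooth_has_derivative[OF assms(2,3)]] .
  show *: "((f \<circ> c) has_field_derivative frechet_derivative f (at (c t)) a) (at t)"
    using has_derivative_compose[OF assms(1)[unfolded has_vector_derivative_def]
        smooth_has_derivative[OF assms(2,3)]]
    by (auto simp: has_field_derivative_def scaleR o_def mult_commute_abs)
  show "deriv (f \<circ> c) t = frechet_derivative f (at (c t)) a"
    by (rule DERIV_imp_deriv[OF *])
qed

lemma velocity_euclidean:
  assumes "(c has_vector_derivative a) (at 0)"
  shows "velocity euclidean_atlas c = directional (c 0) a"
  using deriv_compose_curve(1)[OF assms, of UNIV]
  by (auto simp: velocity_def directional_def fun_eq_iff smooth_functions_euclidean_iff)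

lemma curve_has_vector_derivative:
  assumes "c \<in> curves_through euclidean_atlas S p"
  shows "(c has_vector_derivative vector_derivative c (at 0)) (at 0)"
  using assms smooth_has_vector_derivative[of UNIV c 0] by (simp add: curves_through_euclidean_iff)

lemma velocity_euclidean_curve:
  assumes "c \<in> curves_through euclidean_atlas S p"
  shows "velocity euclidean_atlas c = directional p (vector_derivative c (at 0))"
  using velocity_euclidean[OF curve_has_vector_derivative[OF assms]] assms
  by (simp add: curves_through_def)

lemma tangent_space_euclidean:
  "tangent_space euclidean_atlas S p = directional p ` tangent_vectors S p"
  unfolding tangent_space_def tangent_vectors_def image_image
  by (rule image_cong[OF refl velocity_euclidean_curve])

lemma directional_bounded_linear:
  assumes "bounded_linear h"
  shows "directional p a h = h a"
proof -
  have "frechet_derivative h (at p) = h"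
    using frechet_derivative_at[OF bounded_linear_imp_has_derivative[OF assms]] by simp
  then show ?thesis
    by (simp add: directional_def smooth_functions_euclidean_iff smooth_bounded_linear assms)
qed

text \<open>The functionals form an infinite-dimensional space, so dimensions of images are compared
  in a setting where only the source is finite-dimensional.\<close>

interpretation functional_pair:
  finite_dimensional_vector_space_pair_1 "scaleR :: real \<Rightarrow> 'a \<Rightarrow> 'a" "Basis :: 'a::euclidean_space set"
    "functional_scale :: real \<Rightarrow> 'b functional \<Rightarrow> 'b functional"
  by unfold_locales

lemma linear_directional: "Vector_Spaces.linear (*\<^sub>R) functional_scale (directional p)"
proof -
  have *: "linear (frechet_derivative f (at p))" if "f \<in> smooth_functions euclidean_atlas" for f
    using that unfolding smooth_functions_euclidean_iff
    by (intro has_derivative_linear[OF smooth_has_derivative]) auto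
  have add: "directional p (x + y) = directional p x + directional p y" for x y
    by (auto simp: directional_def fun_eq_iff linear_add[OF *])
  have scale: "directional p (r *\<^sub>R x) = functional_scale r (directional p x)" for r x
    by (auto simp: directional_def fun_eq_iff functional_scale_def linear_scale[OF *])
  show ?thesis
    by unfold_locales (fact add, fact scale)
qed

text \<open>Coordinates are linear and hence smooth functions, so testing on them recovers the
  vector.\<close>

lemma inj_directional: "inj (directional p)"
proof (rule injI)
  fix a b assume *: "directional p a = directional p b"
  have "a \<bullet> i = b \<bullet> i" for i
    using fun_cong[OF *, of "\<lambda>x. x \<bullet> i"]
    unfolding directional_bounded_linear[OF bounded_linear_inner_left] .
  then show "a = b" using euclidean_eqI[of a b] by blast
qed

lemma dim_directional: "functional.dim (directional p ` V) = dim V"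
  by (rule functional_pair.dim_image_eq[OF linear_directional inj_on_subset[OF inj_directional subset_UNIV]])

lemma std_form_directional:
  fixes a b :: "complex ^ 'n::finite"
  shows "std_form q (directional p a) (directional p b) =
    (\<Sum>j\<in>UNIV. Re (a $ j) * Im (b $ j) - Im (a $ j) * Re (b $ j))"
proof -
  have "bounded_linear (\<lambda>z. Re (z $ j))" "bounded_linear (\<lambda>z. Im (z $ j))" for j :: "'n::finite"
    by (rule bounded_linear_compose[OF bounded_linear_Re bounded_linear_vec_nth]
        bounded_linear_compose[OF bounded_linear_Im bounded_linear_vec_nth])+
  note this[THEN directional_bounded_linear]
  then show ?thesis by (simp add: std_form_def)
qed

section \<open>The projective space as a manifold\<close>

lemma norm_vector_scalar_mult: "norm (c *s x) = norm c * norm x" for x :: "complex ^ 'n::finite"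
  by (simp add: norm_vec_def norm_mult L2_set_right_distrib)

lemma bounded_bilinear_vector_scalar_mult:
  "bounded_bilinear ((*s) :: complex \<Rightarrow> complex ^ 'n \<Rightarrow> complex ^ 'n::finite)"
proof
  show "\<exists>K. \<forall>a (b :: complex ^ 'n). norm (a *s b) \<le> norm a * norm b * K"
    by (rule exI[of _ 1]) (simp add: norm_vector_scalar_mult)
qed (simp_all add: vec_eq_iff algebra_simps)

lemma bounded_linear_vector_scalar_mult_left:
  "bounded_linear (\<lambda>c. c *s (z :: complex ^ 'n::finite))"
  by (rule bounded_bilinear.bounded_linear_left[OF bounded_bilinear_vector_scalar_mult])

lemma bounded_linear_vector_scalar_mult_right:
  "bounded_linear ((*s) c :: complex ^ 'n::finite \<Rightarrow> _)"
  by (rule bounded_bilinear.bounded_linear_right[OF bounded_bilinear_vector_scalar_mult])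

lemma ex_nonzero_component: "z \<noteq> 0 \<longleftrightarrow> (\<exists>i. z $ i \<noteq> 0)" for z :: "complex ^ 'n"
  by (simp add: vec_eq_iff)

lemma mem_line_self: "z \<in> line z"
  unfolding line_def by (rule range_eqI[of _ _ 1]) simp

lemma line_scale: "c \<noteq> 0 \<Longrightarrow> line (c *s z) = line z"
proof -
  assume c: "c \<noteq> 0"
  have "d *s z \<in> line (c *s z)" for d
    unfolding line_def by (rule range_eqI[of _ _ "d / c"]) (simp add: c)
  then have "line z \<subseteq> line (c *s z)" unfolding line_def[of z] by blast
  moreover have "line (c *s z) \<subseteq> line z"
    unfolding line_def by (simp add: image_subset_iff) blast
  ultimately show ?thesis by (rule equalityI[rotated])
qed

lemma line_eq_iff: "z \<noteq> 0 \<Longrightarrow> line w = line z \<longleftrightarrow> (\<exists>c. c \<noteq> 0 \<and> w = c *s z)"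
proof
  assume z: "z \<noteq> 0" and "line w = line z"
  then have "w \<in> line z" "z \<in> line w"
    using mem_line_self[of z] mem_line_self[of w] by simp_all
  then obtain c d where c: "w = c *s z" and d: "z = d *s w"
    unfolding line_def by (elim rangeE)
  have "c \<noteq> 0"
  proof
    assume "c = 0"
    then show False using z unfolding c by (subst (asm) d) (simp add: c)
  qed
  then show "\<exists>c. c \<noteq> 0 \<and> w = c *s z" using c by blast
qed (auto simp: line_scale)

definition affine_domain :: "'n \<Rightarrow> (complex ^ 'n) set set" where
  "affine_domain i = {line z | z. z $ i \<noteq> 0}"

definition affine_chart :: "'n \<Rightarrow> (complex ^ 'n) set \<Rightarrow> complex ^ 'n" where
  "affine_chart i = (\<lambda>L. THE w. w \<in> L \<and> w $ i = 1)"

lemma proj_atlas_eq: "proj_atlas = range (\<lambda>i. (affine_domain i, affine_chart i))"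
  by (auto simp: proj_atlas_def affine_domain_def affine_chart_def)

lemma line_in_affine_domain_iff [simp]: "line z \<in> affine_domain i \<longleftrightarrow> z $ i \<noteq> 0"
proof
  assume "line z \<in> affine_domain i"
  then obtain w where w: "line z = line w" "w $ i \<noteq> 0" by (auto simp: affine_domain_def)
  then have "w \<noteq> 0" by auto
  with w show "z $ i \<noteq> 0" by (auto simp: line_eq_iff)
qed (auto simp: affine_domain_def)

lemma affine_chart_line: "z $ i \<noteq> 0 \<Longrightarrow> affine_chart i (line z) = inverse (z $ i) *s z"
  unfolding affine_chart_def by (rule the_equality) (auto simp: line_def field_simps)

lemma line_affine_chart: "L \<in> affine_domain i \<Longrightarrow> line (affine_chart i L) = L"
  by (auto simp: affine_domain_def affine_chart_line line_scale)

lemma inj_on_affine_chart: "inj_on (affine_chart i) (affine_domain i)"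
  by (rule inj_on_inverseI[of _ line]) (rule line_affine_chart)

lemma affine_chart_image: "affine_chart i ` {L \<in> affine_domain i. P L} = {w. w $ i = 1 \<and> P (line w)}"
proof (intro equalityI subsetI)
  fix w assume "w \<in> {w. w $ i = 1 \<and> P (line w)}"
  then have "w = affine_chart i (line w)" "line w \<in> {L \<in> affine_domain i. P L}"
    by (simp_all add: affine_chart_line)
  then show "w \<in> affine_chart i ` {L \<in> affine_domain i. P L}" by (rule image_eqI)
next
  fix w assume "w \<in> affine_chart i ` {L \<in> affine_domain i. P L}"
  then obtain z where "w = inverse (z $ i) *s z" "z $ i \<noteq> 0" "P (line z)"
    by (auto simp: affine_domain_def affine_chart_line)
  then show "w \<in> {w. w $ i = 1 \<and> P (line w)}" by (simp add: line_scale)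
qed

lemma affine_chart_range: "affine_chart i ` affine_domain i = {w. w $ i = 1}"
  using affine_chart_image[of i "\<lambda>_. True"] by simp

lemma inv_into_affine_chart: "w $ i = 1 \<Longrightarrow> inv_into (affine_domain i) (affine_chart i) w = line w"
  using inv_into_f_f[OF inj_on_affine_chart, of "line w" i] by (simp add: affine_chart_line)

lemma points_proj_atlas: "points proj_atlas = line ` (- {0})"
proof -
  have "(\<Union>i. affine_domain i) = line ` (- {0})"
  proof (intro equalityI subsetI)
    fix L assume "L \<in> (\<Union>i. affine_domain i)"
    then obtain i z where "L = line z" "z $ i \<noteq> 0"
      by (auto simp: affine_domain_def)
    then show "L \<in> line ` (- {0})" using ex_nonzero_component[of z] by blast
  next
    fix L assume "L \<in> line ` (- {0})"
    then obtain z where "L = line z" "z \<noteq> 0" by blast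
    then show "L \<in> (\<Union>i. affine_domain i)" using ex_nonzero_component[of z] by auto
  qed
  then show ?thesis by (simp add: points_def proj_atlas_eq)
qed

lemma inj_on_proj_atlas: "(U, \<phi>) \<in> proj_atlas \<Longrightarrow> inj_on \<phi> U"
  by (auto simp: proj_atlas_eq inj_on_affine_chart)

lemma topspace_proj: "topspace (atlas_topology proj_atlas) = line ` (- {0})"
  by (simp add: topspace_atlas_topology[OF inj_on_proj_atlas] points_proj_atlas)

section \<open>Topology, smooth functions and smooth curves of the projective space\<close>

lemma smooth_component: "open W \<Longrightarrow> smooth W (\<lambda>z :: complex ^ 'n::finite. z $ i)"
  by (rule smooth_bounded_linear[OF _ bounded_linear_vec_nth])

lemma open_component_nonzero: "open {z :: complex ^ 'n. z $ i \<noteq> 0}"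
  by (intro open_Collect_neq continuous_intros)

lemma smooth_affine_normalize:
  assumes "smooth W f" "\<And>x. x \<in> W \<Longrightarrow> f x $ i \<noteq> 0"
  shows "smooth W (\<lambda>x. inverse (f x $ i) *s (f x :: complex ^ 'n::finite))"
  using assms
  by (intro smooth_bilinear[OF bounded_bilinear_vector_scalar_mult] smooth_inverse_compose
      smooth_linear_compose[OF bounded_linear_vec_nth]) auto

text \<open>Cutting an open cone with the slice \<open>w $ i = 1\<close> gives a relatively open
  set; conversely, normalization of the i-th coordinate, continuous where it is nonzero, pulls such
  sets back to open cones. So the atlas topology is the quotient topology on lines.\<close>

lemma openin_proj_iff:
  "openin (atlas_topology proj_atlas) T \<longleftrightarrow>
    T \<subseteq> line ` (- {0}) \<and> open {z :: complex ^ 'n::finite. z \<noteq> 0 \<and> line z \<in> T}"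
proof -
  let ?A = "{z. z \<noteq> 0 \<and> line z \<in> T}"
  have eq: "affine_chart i ` (T \<inter> affine_domain i) = {w. w $ i = 1 \<and> line w \<in> T}" for i
    using affine_chart_image[of i "\<lambda>L. L \<in> T"] by (simp add: Int_def conj_commute)
  have "(\<forall>i. openin (top_of_set {w. w $ i = 1}) {w. w $ i = 1 \<and> line w \<in> T}) \<longleftrightarrow> open ?A"
  proof (intro iffI allI)
    assume L: "\<forall>i. openin (top_of_set {w. w $ i = 1}) {w. w $ i = 1 \<and> line w \<in> T}"
    then have "\<forall>i. \<exists>W. open W \<and> {w. w $ i = 1 \<and> line w \<in> T} = {w. w $ i = 1} \<inter> W"
      by (simp add: openin_open)
    from choice[OF this] obtain W where W: "\<And>i. open (W i)"
        "\<And>i. {w. w $ i = 1 \<and> line w \<in> T} = {w. w $ i = 1} \<inter> W i"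
      by blast
    \<comment> \<open>\<open>W i\<close> is related to T only on the slice, so a vector is
      normalized before it is tested.\<close>
    have *: "line z \<in> T \<longleftrightarrow> inverse (z $ i) *s z \<in> W i" if "z $ i \<noteq> 0" for z i
    proof -
      have "inverse (z $ i) *s z \<in> {w. w $ i = 1 \<and> line w \<in> T} \<longleftrightarrow> line z \<in> T"
        using that by (simp add: line_scale)
      then show ?thesis using that unfolding W(2) by simp
    qed
    have "open ({z. z $ i \<noteq> 0} \<inter> (\<lambda>z. inverse (z $ i) *s z) -` W i)" for i
      using smooth_affine_normalize[OF smooth_id[OF open_component_nonzero]]
      by (intro continuous_open_preimage smooth_continuous_on W open_component_nonzero) simp
    moreover have "?A = (\<Union>i. {z. z $ i \<noteq> 0} \<inter> (\<lambda>z. inverse (z $ i) *s z) -` W i)"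
    proof (intro equalityI subsetI)
      fix z assume z: "z \<in> ?A"
      then obtain i where "z $ i \<noteq> 0" by (auto simp: ex_nonzero_component)
      then show "z \<in> (\<Union>i. {z. z $ i \<noteq> 0} \<inter> (\<lambda>z. inverse (z $ i) *s z) -` W i)"
        using *[of z i] z by blast
    next
      fix z assume "z \<in> (\<Union>i. {z. z $ i \<noteq> 0} \<inter> (\<lambda>z. inverse (z $ i) *s z) -` W i)"
      then obtain i where "z $ i \<noteq> 0" "inverse (z $ i) *s z \<in> W i" by blast
      then show "z \<in> ?A" using *[of z i] ex_nonzero_component[of z] by blast
    qed
    ultimately show "open ?A" by (simp add: open_UN)
  next
    fix i assume "open ?A"
    moreover have "{w. w $ i = 1 \<and> line w \<in> T} = {w. w $ i = 1} \<inter> ?A" by auto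
    ultimately show "openin (top_of_set {w. w $ i = 1}) {w. w $ i = 1 \<and> line w \<in> T}"
      unfolding openin_open by blast
  qed
  then show ?thesis
    by (simp add: openin_atlas_topology[OF inj_on_proj_atlas] points_proj_atlas)
      (simp add: proj_atlas_eq eq affine_chart_range)
qed

text \<open>A chart sees only the slice \<open>w $ i = 1\<close>, which is not open. Composing a
  local extension with the normalization gives smoothness on an open set of vectors; conversely
  \<open>f \<circ> line\<close> itself extends the chart expression off the slice. Smoothness can
  then be tested without charts.\<close>

lemma smooth_functions_proj_iff:
  "f \<in> smooth_functions proj_atlas \<longleftrightarrow> smooth (- {0}) (\<lambda>z :: complex ^ 'n::finite. f (line z))"
proof -
  have charts: "(\<forall>(U, \<phi>)\<in>proj_atlas. \<forall>(V, \<psi>)\<in>euclidean_atlas.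
      smooth_on (\<phi> ` (U \<inter> f -` V)) (\<psi> \<circ> f \<circ> inv_into U \<phi>)) \<longleftrightarrow>
    (\<forall>i. smooth_on {w. w $ i = 1} (f \<circ> inv_into (affine_domain i) (affine_chart i)))"
    by (simp add: proj_atlas_eq euclidean_atlas_def affine_chart_range o_def)
  show ?thesis
  proof
    assume "f \<in> smooth_functions proj_atlas"
    then have f: "smooth_on {w. w $ i = 1} (f \<circ> inv_into (affine_domain i) (affine_chart i))" for i
      using charts by (simp add: smooth_functions_def smooth_map_def)
    have "smooth_on (- {0}) (\<lambda>z. f (line z))"
      unfolding smooth_on_def
    proof
      fix z :: "complex ^ 'n" assume "z \<in> - {0}"
      then obtain i where i: "z $ i \<noteq> 0" by (auto simp: ex_nonzero_component)
      then have "inverse (z $ i) *s z \<in> {w. w $ i = 1}" by simp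
      from bspec[OF f[of i, unfolded smooth_on_def] this] obtain W g
        where W: "open W" "inverse (z $ i) *s z \<in> W" "\<forall>k. Ck_on k W g"
          and g: "\<forall>y\<in>W \<inter> {w. w $ i = 1}. g y = (f \<circ> inv_into (affine_domain i) (affine_chart i)) y"
        by (elim exE conjE)
      let ?n = "\<lambda>z :: complex ^ 'n. inverse (z $ i) *s z"
      let ?V = "{z. z $ i \<noteq> 0} \<inter> ?n -` W"
      have n: "smooth {z. z $ i \<noteq> 0} ?n"
        by (rule smooth_affine_normalize[OF smooth_id[OF open_component_nonzero]]) simp
      have V: "open ?V"
        by (intro continuous_open_preimage smooth_continuous_on[OF n] W open_component_nonzero)
      have "smooth ?V (\<lambda>z. g (?n z))"
        by (rule smooth_compose[of _ _ W, OF smooth_subset[OF n V]]) (auto simp: smooth_def W)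
      moreover have "g (?n y) = f (line y)" if "y \<in> ?V" for y
        using bspec[OF g, of "?n y"] that by (simp add: inv_into_affine_chart line_scale)
      ultimately show "\<exists>W g. open W \<and> z \<in> W \<and> (\<forall>k. Ck_on k W g) \<and> (\<forall>y\<in>W \<inter> - {0}. g y = f (line y))"
        using i W(2) V by (intro exI[of _ ?V] exI[of _ "\<lambda>z. g (?n z)"]) (auto simp: smooth_def)
    qed
    then show "smooth (- {0}) (\<lambda>z. f (line z))" by (simp add: smooth_on_eq_smooth)
  next
    assume f: "smooth (- {0}) (\<lambda>z. f (line z))"
    have "smooth_on {w. w $ i = 1} (f \<circ> inv_into (affine_domain i) (affine_chart i))" for i
      by (rule smooth_onI[OF f]) (auto simp: inv_into_affine_chart)
    moreover have "continuous_map (atlas_topology proj_atlas) euclidean f"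
      unfolding continuous_map_def
    proof (intro conjI allI impI)
      fix V :: "real set" assume "openin euclidean V"
      then have "open (- {0} \<inter> (\<lambda>z. f (line z)) -` V)"
        by (intro continuous_open_preimage smooth_continuous_on[OF f]) auto
      moreover have "- {0} \<inter> (\<lambda>z. f (line z)) -` V =
          {z. z \<noteq> 0 \<and> line z \<in> {x \<in> topspace (atlas_topology proj_atlas). f x \<in> V}}"
        by (auto simp: topspace_proj)
      ultimately show "openin (atlas_topology proj_atlas) {x \<in> topspace (atlas_topology proj_atlas). f x \<in> V}"
        unfolding openin_proj_iff by (simp add: topspace_proj subset_iff)
    qed simp
    ultimately show "f \<in> smooth_functions proj_atlas"
      by (simp add: smooth_functions_def smooth_map_def charts)
  qed
qed

lemma smooth_map_line_compose:
  fixes c :: "real \<Rightarrow> complex ^ 'n::finite"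
  assumes c: "smooth UNIV c" "\<And>t. c t \<noteq> 0"
  shows "smooth_map euclidean_atlas proj_atlas (line \<circ> c)"
  unfolding smooth_map_def
proof (intro conjI)
  show "continuous_map (atlas_topology euclidean_atlas) (atlas_topology proj_atlas) (line \<circ> c)"
    unfolding continuous_map_def
  proof (intro conjI allI impI)
    show "line \<circ> c \<in> topspace (atlas_topology euclidean_atlas) \<rightarrow> topspace (atlas_topology proj_atlas)"
      using c(2) by (auto simp: topspace_proj)
    fix T :: "(complex ^ 'n) set set" assume "openin (atlas_topology proj_atlas) T"
    then have "open {z. z \<noteq> 0 \<and> line z \<in> T}" by (simp add: openin_proj_iff)
    then have "open (UNIV \<inter> c -` {z. z \<noteq> 0 \<and> line z \<in> T})"
      by (intro continuous_open_preimage smooth_continuous_on[OF c(1)]) auto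
    then show "openin (atlas_topology euclidean_atlas)
        {x \<in> topspace (atlas_topology euclidean_atlas). (line \<circ> c) x \<in> T}"
      by (simp add: c(2) vimage_def)
  qed
  have "smooth_on {t. c t $ i \<noteq> 0} (\<lambda>t. affine_chart i (line (c t)))" for i
  proof -
    have "open (UNIV \<inter> c -` {z. z $ i \<noteq> 0})"
      by (intro continuous_open_preimage smooth_continuous_on[OF c(1)] open_component_nonzero) auto
    then have "smooth {t. c t $ i \<noteq> 0} (\<lambda>t. inverse (c t $ i) *s c t)"
      by (intro smooth_affine_normalize smooth_subset[OF c(1)]) (auto simp: vimage_def)
    then show ?thesis by (rule smooth_onI) (auto simp: affine_chart_line)
  qed
  then show "\<forall>(U, \<phi>)\<in>euclidean_atlas. \<forall>(V, \<psi>)\<in>proj_atlas.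
      smooth_on (\<phi> ` (U \<inter> (line \<circ> c) -` V)) (\<psi> \<circ> (line \<circ> c) \<circ> inv_into U \<phi>)"
    by (simp add: proj_atlas_eq euclidean_atlas_def vimage_def o_def)
qed

text \<open>Chart domains are open in the atlas topology, so the times spent in one of them form an
  open set, on which \<open>smooth_on\<close> is ordinary smoothness.\<close>

lemma smooth_curve_affine_chart:
  fixes \<gamma> :: "real \<Rightarrow> (complex ^ 'n::finite) set"
  assumes "smooth_map euclidean_atlas proj_atlas \<gamma>"
  shows "smooth {t. \<gamma> t \<in> affine_domain i} (\<lambda>t. affine_chart i (\<gamma> t))"
proof -
  have "{z. z \<noteq> 0 \<and> line z \<in> affine_domain i} = {z :: complex ^ 'n. z $ i \<noteq> 0}" by auto
  then have "openin (atlas_topology proj_atlas) (affine_domain i)"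
    unfolding openin_proj_iff using open_component_nonzero[of i]
    by (auto simp: affine_domain_def)
  then have "open {t. \<gamma> t \<in> affine_domain i}"
    using assms by (auto simp: smooth_map_def continuous_map_def)
  moreover have "smooth_on {t. \<gamma> t \<in> affine_domain i} (\<lambda>t. affine_chart i (\<gamma> t))"
    using assms by (simp add: smooth_map_def proj_atlas_eq euclidean_atlas_def vimage_def o_def)
  ultimately show ?thesis by (simp add: smooth_on_eq_smooth)
qed

section \<open>Tangent vectors of the projective space\<close>

text \<open>The image of the vector \<open>a\<close> at \<open>z\<close> under the differential of the map \<open>line\<close>.\<close>

definition projected :: "complex ^ 'n::finite \<Rightarrow> complex ^ 'n \<Rightarrow> ((complex ^ 'n) set) functional" where
  "projected z a =
     (\<lambda>f. if f \<in> smooth_functions proj_atlas then frechet_derivative (f \<circ> line) (at z) a else 0)"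

lemma smooth_proj_has_derivative:
  assumes "f \<in> smooth_functions proj_atlas" "z \<noteq> 0"
  shows "((f \<circ> line) has_derivative frechet_derivative (f \<circ> line) (at z)) (at z)"
  using smooth_has_derivative[of "- {0}" "f \<circ> line" z] assms
  by (simp add: smooth_functions_proj_iff o_def)

lemma linear_projected:
  assumes "z \<noteq> 0"
  shows "Vector_Spaces.linear (*\<^sub>R) functional_scale (projected z)"
proof -
  have *: "linear (frechet_derivative (f \<circ> line) (at z))" if "f \<in> smooth_functions proj_atlas" for f
    by (rule has_derivative_linear[OF smooth_proj_has_derivative[OF that assms]])
  have add: "projected z (x + y) = projected z x + projected z y" for x y
    by (auto simp: projected_def fun_eq_iff linear_add[OF *])
  have scale: "projected z (r *\<^sub>R x) = functional_scale r (projected z x)" for r x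
    by (auto simp: projected_def fun_eq_iff functional_scale_def linear_scale[OF *])
  show ?thesis
    by unfold_locales (fact add, fact scale)
qed

lemma velocity_line_compose:
  assumes "(c has_vector_derivative a) (at 0)" "c 0 \<noteq> 0"
  shows "velocity proj_atlas (line \<circ> c) = projected (c 0) a"
proof
  fix f
  show "velocity proj_atlas (line \<circ> c) f = projected (c 0) a f"
  proof (cases "f \<in> smooth_functions proj_atlas")
    case True
    then have "smooth (- {0}) (f \<circ> line)" by (simp add: smooth_functions_proj_iff o_def)
    from deriv_compose_curve(1)[OF assms(1) this] show ?thesis
      using assms(2) True by (simp add: velocity_def projected_def comp_assoc)
  qed (simp add: velocity_def projected_def)
qed

text \<open>This differentiates the invariance of \<open>line\<close> under multiplication by u. It
  compares representatives of one line, as the independence of \<open>reduced_form\<close> from the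
  base point requires.\<close>

lemma projected_scale:
  assumes "u \<noteq> 0" "z \<noteq> 0"
  shows "projected (u *s z) (u *s a) = projected z a"
proof
  fix f
  show "projected (u *s z) (u *s a) f = projected z a f"
  proof (cases "f \<in> smooth_functions proj_atlas")
    case True
    have "u *s z \<noteq> 0" using assms by simp
    from has_derivative_compose[OF bounded_linear_imp_has_derivative[OF
          bounded_linear_vector_scalar_mult_right]
        smooth_proj_has_derivative[OF True \<open>u *s z \<noteq> 0\<close>]]
    have "((f \<circ> line) has_derivative
        (\<lambda>b. frechet_derivative (f \<circ> line) (at (u *s z)) (u *s b))) (at z)"
      using assms(1) by (simp add: line_scale o_def)
    from frechet_derivative_at[OF this] show ?thesis
      using True by (simp add: projected_def fun_eq_iff)
  qed (simp add: projected_def)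
qed

text \<open>Test functions must be smooth on the whole projective space, which the quotients
  \<open>w $ j / w $ i\<close> are in general not. Instead, \<open>F j\<close> is the entry in row j
  and column i of the orthogonal projection onto the line of w, which is invariant under scaling and
  smooth for nonzero w. Since \<open>z $ i\<close> is nonzero, column i alone determines a up to a
  multiple of z.\<close>

lemma projected_eq_0_imp:
  fixes z a :: "complex ^ 'n::finite"
  assumes z: "z \<noteq> 0" and a: "projected z a = 0"
  shows "\<exists>c. a = c *s z"
proof -
  obtain i where i: "z $ i \<noteq> 0" using z by (auto simp: ex_nonzero_component)
  let ?g = "\<lambda>w :: complex ^ 'n. inverse (w \<bullet> w)"
  define F where "F j = (\<lambda>w :: complex ^ 'n. ?g w *\<^sub>R (w $ j * cnj (w $ i)))" for j
  have g: "smooth (- {0}) ?g"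
    by (intro smooth_inverse_compose smooth_bilinear[OF bounded_bilinear_inner] smooth_id) auto
  have F: "smooth (- {0}) (F j)" for j
    unfolding F_def
    by (intro smooth_scaleR g smooth_bilinear[OF bounded_bilinear_mult]
        smooth_linear_compose[OF bounded_linear_cnj] smooth_component) simp_all
  define G where "G = frechet_derivative ?g (at z) a"
  have F': "frechet_derivative (F j) (at z) a =
      ?g z *\<^sub>R (z $ j * cnj (a $ i) + a $ j * cnj (z $ i)) + G *\<^sub>R (z $ j * cnj (z $ i))" for j
  proof -
    have "(F j has_derivative (\<lambda>b. ?g z *\<^sub>R (z $ j * cnj (b $ i) + b $ j * cnj (z $ i)) +
        frechet_derivative ?g (at z) b *\<^sub>R (z $ j * cnj (z $ i)))) (at z)"
      unfolding F_def using z
      by (intro has_derivative_scaleR has_derivative_mult has_derivative_cnj smooth_has_derivative[OF g]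
          bounded_linear_imp_has_derivative bounded_linear_vec_nth) simp
    from fun_cong[OF frechet_derivative_at[OF this], of a, symmetric] show ?thesis
      unfolding G_def .
  qed
  have invariant: "F j (c *s w) = F j w" if "c \<noteq> 0" for c w j
  proof -
    have "(c *s w) \<bullet> (c *s w) = (cmod c)\<^sup>2 * (w \<bullet> w)"
      by (simp add: dot_square_norm norm_vector_scalar_mult power_mult_distrib)
    moreover have "c * w $ j * cnj (c * w $ i) = (cmod c)\<^sup>2 *\<^sub>R (w $ j * cnj (w $ i))"
      using complex_norm_square[of c] by (simp add: scaleR_conv_of_real mult_ac)
    ultimately show ?thesis using that by (simp add: F_def field_simps)
  qed
  have deriv0: "frechet_derivative (F j) (at z) a = 0" for j
  proof -
    have part: "h (frechet_derivative (F j) (at z) a) = 0" if h: "bounded_linear h" for h :: "complex \<Rightarrow> real"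
    proof -
      \<comment> \<open>The choice of a representative is harmless by \<open>invariant\<close>.
        Tangent vectors act on real functions, so the real and imaginary parts h of
        \<open>F j\<close> are tested separately.\<close>
      define f where "f L = h (F j (SOME w. w \<noteq> 0 \<and> line w = L))" for L
      have f: "f (line w) = h (F j w)" if w: "w \<noteq> 0" for w
      proof -
        let ?v = "SOME v. v \<noteq> 0 \<and> line v = line w"
        have "?v \<noteq> 0 \<and> line ?v = line w" by (rule someI[of _ w]) (simp add: w)
        then obtain c where "c \<noteq> 0" "?v = c *s w" using line_eq_iff[OF w] by blast
        then show ?thesis unfolding f_def by (simp add: invariant)
      qed
      have "smooth (- {0}) (\<lambda>w. h (F j w))" by (rule smooth_linear_compose[OF h F])
      then have "smooth (- {0}) (\<lambda>w. f (line w))" by (rule smooth_cong) (simp add: f)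
      then have fs: "f \<in> smooth_functions proj_atlas" by (simp add: smooth_functions_proj_iff)
      have "((\<lambda>w. h (F j w)) has_derivative (\<lambda>b. h (frechet_derivative (F j) (at z) b))) (at z)"
        using z by (intro bounded_linear.has_derivative[OF h] smooth_has_derivative[OF F]) simp
      then have "((f \<circ> line) has_derivative (\<lambda>b. h (frechet_derivative (F j) (at z) b))) (at z)"
        by (rule has_derivative_transform_within_open[of _ _ _ _ "- {0}"]) (simp_all add: z f)
      from frechet_derivative_at[OF this] fun_cong[OF a, of f] fs show ?thesis
        by (simp add: projected_def) metis
    qed
    show ?thesis
      using part[OF bounded_linear_Re] part[OF bounded_linear_Im] by (simp add: complex_eq_iff)
  qed
  have gz: "?g z \<noteq> 0" using z by simp
  \<comment> \<open>Setting \<open>F'\<close> to 0 and dividing by \<open>?g z\<close>, one solves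
    for \<open>a $ j * cnj (z $ i)\<close>; the coefficient of \<open>z $ j\<close> is the same for
    every j.\<close>
  define c where "c = - (cnj (a $ i) + (G / ?g z) *\<^sub>R cnj (z $ i)) / cnj (z $ i)"
  have "a $ j = c * z $ j" for j
  proof -
    have "?g z *\<^sub>R (z $ j * cnj (a $ i) + a $ j * cnj (z $ i) + (G / ?g z) *\<^sub>R (z $ j * cnj (z $ i))) = 0"
      using deriv0[of j] gz unfolding F' by (simp add: scaleR_right_distrib)
    then have "z $ j * cnj (a $ i) + a $ j * cnj (z $ i) + (G / ?g z) *\<^sub>R (z $ j * cnj (z $ i)) = 0"
      using gz by simp
    then have "a $ j * cnj (z $ i) = - (cnj (a $ i) + (G / ?g z) *\<^sub>R cnj (z $ i)) * z $ j"
      by (simp add: algebra_simps eq_neg_iff_add_eq_0)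
    then show ?thesis using i by (simp add: c_def field_simps)
  qed
  then have "a = c *s z" by (simp add: vec_eq_iff)
  then show ?thesis ..
qed

lemma vector_scalar_mult_scaleR: "u *s (r *\<^sub>R x) = (u * of_real r) *s x"
  for x :: "complex ^ 'n"
  by (simp add: vec_eq_iff) (simp add: scaleR_conv_of_real)

text \<open>\<open>curves_through\<close> demands curves defined for all real times, so a curve
  cannot simply be restricted to an interval. A sine of frequency \<open>2 / e\<close> and amplitude
  \<open>e / 2\<close> stays within e and has slope 1 at 0, which preserves the velocity
  there.\<close>

lemma smooth_bounded_reparametrization:
  assumes "0 < e"
  obtains \<theta> :: "real \<Rightarrow> real"
  where "smooth UNIV \<theta>" "\<theta> 0 = 0" "(\<theta> has_field_derivative 1) (at 0)" "\<And>t. \<bar>\<theta> t\<bar> < e"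
proof
  let ?\<theta> = "\<lambda>t. (e / 2) * sin ((2 / e) * t)"
  show "smooth UNIV ?\<theta>"
    by (intro smooth_linear_compose[OF bounded_linear_mult_right] smooth_id
        smooth_compose[OF _ smooth_sin]) auto
  show "(?\<theta> has_field_derivative 1) (at 0)"
    using assms by (auto intro!: derivative_eq_intros)
  show "\<bar>?\<theta> t\<bar> < e" for t
  proof -
    have "\<bar>?\<theta> t\<bar> \<le> (e / 2) * 1"
      unfolding abs_mult using assms by (intro mult_mono) auto
    then show ?thesis using assms by simp
  qed
qed simp

abbreviation unit_cone :: "(complex ^ 'n::finite) set set \<Rightarrow> (complex ^ 'n) set" where
  "unit_cone S \<equiv> {w \<in> sphere 0 1. line w \<in> S}"

text \<open>Only a germ of the curve matters for the velocity, so the curve may be slowed down until it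
  stays in one affine chart, where it has an explicit lift.\<close>

lemma lift_curve:
  fixes z :: "complex ^ 'n::finite"
  assumes \<gamma>: "\<gamma> \<in> curves_through proj_atlas S (line z)" and z: "norm z = 1"
  obtains c where "c \<in> curves_through euclidean_atlas (unit_cone S) z"
    "velocity proj_atlas (line \<circ> c) = velocity proj_atlas \<gamma>"
proof -
  have \<gamma>': "smooth_map euclidean_atlas proj_atlas \<gamma>" "\<gamma> 0 = line z" "range \<gamma> \<subseteq> S"
    using \<gamma> by (auto simp: curves_through_def)
  have "z \<noteq> 0" using z by auto
  then obtain i where i: "z $ i \<noteq> 0" by (auto simp: ex_nonzero_component)
  define V where "V = {t. \<gamma> t \<in> affine_domain i}"
  define w where "w t = affine_chart i (\<gamma> t)" for t
  have w: "smooth V w"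
    unfolding V_def w_def by (rule smooth_curve_affine_chart[OF \<gamma>'(1)])
  have w0: "w 0 = inverse (z $ i) *s z" using i by (simp add: w_def \<gamma>'(2) affine_chart_line)
  have "0 \<in> V" using i by (simp add: V_def \<gamma>'(2))
  then obtain e where e: "0 < e" "ball 0 e \<subseteq> V"
    using smooth_open[OF w] openE by blast
  obtain \<theta> where \<theta>: "smooth UNIV \<theta>" "\<theta> 0 = 0" "(\<theta> has_field_derivative 1) (at 0)" "\<And>t. \<bar>\<theta> t\<bar> < e"
    using smooth_bounded_reparametrization[OF e(1)] by blast
  have \<theta>V: "\<theta> t \<in> V" for t using \<theta>(4)[of t] e(2) by (auto simp: subset_iff)
  have line_w: "line (w t) = \<gamma> t" if "t \<in> V" for t
    using that by (simp add: V_def w_def line_affine_chart)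
  have w_nz: "w t \<noteq> 0" if "t \<in> V" for t
  proof -
    have "w t \<in> {v. v $ i = 1}"
      using that unfolding affine_chart_range[symmetric] w_def V_def by simp
    then show ?thesis by auto
  qed
  \<comment> \<open>Since \<open>w 0\<close> is z divided by \<open>z $ i\<close> and z is a unit
    vector, u is the phase of \<open>z $ i\<close>; it makes the normalized lift start exactly at
    z.\<close>
  define u where "u = z $ i * of_real (norm (w 0))"
  define c where "c t = u *s (inverse (norm (w (\<theta> t))) *\<^sub>R w (\<theta> t))" for t
  have norm_u: "norm u = 1"
    using i z by (simp add: u_def w0 norm_vector_scalar_mult norm_mult norm_inverse)
  then have "u \<noteq> 0" by auto
  have line_c: "line (c t) = \<gamma> (\<theta> t)" for t
  proof -
    have "c t = (u * of_real (inverse (norm (w (\<theta> t))))) *s w (\<theta> t)"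
      unfolding c_def by (rule vector_scalar_mult_scaleR)
    moreover have "u * of_real (inverse (norm (w (\<theta> t)))) \<noteq> 0"
      using \<open>u \<noteq> 0\<close> w_nz[OF \<theta>V] by simp
    ultimately have "line (c t) = line (w (\<theta> t))" using line_scale by metis
    then show ?thesis using line_w[OF \<theta>V] by simp
  qed
  have norm_c: "norm (c t) = 1" for t
    unfolding c_def norm_vector_scalar_mult norm_u using w_nz[OF \<theta>V] by simp
  have "c 0 = z"
  proof -
    have "c 0 = (u * of_real (inverse (norm (w 0)))) *s w 0"
      unfolding c_def \<theta>(2) by (rule vector_scalar_mult_scaleR)
    also have "u * of_real (inverse (norm (w 0))) = z $ i"
      using w_nz[OF \<open>0 \<in> V\<close>] by (simp add: u_def)
    finally show ?thesis using i by (simp add: w0)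
  qed
  moreover have "smooth UNIV c"
    unfolding c_def
    by (intro smooth_linear_compose[OF bounded_linear_vector_scalar_mult_right]
        smooth_normalize smooth_compose[OF \<theta>(1) w])
      (use \<theta>V w_nz in auto)
  ultimately have "c \<in> curves_through euclidean_atlas (unit_cone S) z"
    using \<gamma>'(3) norm_c line_c by (auto simp: curves_through_euclidean_iff)
  moreover have "velocity proj_atlas (line \<circ> c) = velocity proj_atlas \<gamma>"
  proof
    fix f
    show "velocity proj_atlas (line \<circ> c) f = velocity proj_atlas \<gamma> f"
    proof (cases "f \<in> smooth_functions proj_atlas")
      case True
      then have f: "smooth (- {0}) (f \<circ> line)" by (simp add: smooth_functions_proj_iff o_def)
      \<comment> \<open>\<open>velocity\<close> is defined by \<open>deriv\<close>, so
        differentiability has to be secured before reparametrizing: the lift w supplies it for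
        \<open>f \<circ> \<gamma>\<close> at 0, and \<open>\<theta>\<close> has slope 1
        there.\<close>
      define d where "d = frechet_derivative (f \<circ> line) (at (w 0)) (vector_derivative w (at 0))"
      have "((f \<circ> line \<circ> w) has_field_derivative d) (at 0)"
        unfolding d_def
        using deriv_compose_curve(2)[OF smooth_has_vector_derivative[OF w \<open>0 \<in> V\<close>] f]
          w_nz[OF \<open>0 \<in> V\<close>] by simp
      then have *: "((f \<circ> \<gamma>) has_field_derivative d) (at 0)"
        by (rule has_field_derivative_transform_within_open[OF _ smooth_open[OF w] \<open>0 \<in> V\<close>]) (simp add: line_w)
      then have "((\<lambda>t. (f \<circ> \<gamma>) (\<theta> t)) has_field_derivative d * 1) (at 0)"
        using \<theta>(2,3) by (intro DERIV_chain2[where f = "f \<circ> \<gamma>" and g = \<theta>]) simp_all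
      moreover have "(\<lambda>t. (f \<circ> \<gamma>) (\<theta> t)) = f \<circ> (line \<circ> c)"
        by (simp add: fun_eq_iff line_c)
      ultimately have "((f \<circ> (line \<circ> c)) has_field_derivative d) (at 0)" by simp
      from DERIV_imp_deriv[OF this] DERIV_imp_deriv[OF *] show ?thesis
        by (simp add: velocity_def)
    qed (simp add: velocity_def)
  qed
  ultimately show ?thesis by (rule that)
qed

lemma tangent_space_proj:
  fixes z :: "complex ^ 'n::finite"
  assumes z: "norm z = 1"
  shows "tangent_space proj_atlas S (line z) = projected z ` tangent_vectors (unit_cone S) z"
proof (intro equalityI subsetI)
  have project: "velocity proj_atlas (line \<circ> c) = projected z (vector_derivative c (at 0))"
    if "c \<in> curves_through euclidean_atlas (unit_cone S) z" for c
  proof -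
    have "c 0 = z" using that by (simp add: curves_through_def)
    moreover have "z \<noteq> 0" using z by auto
    ultimately show ?thesis
      using velocity_line_compose[OF curve_has_vector_derivative[OF that]] by simp
  qed
  {
    fix v assume "v \<in> tangent_space proj_atlas S (line z)"
    then obtain \<gamma> where \<gamma>: "\<gamma> \<in> curves_through proj_atlas S (line z)" "v = velocity proj_atlas \<gamma>"
      unfolding tangent_space_def by blast
    from lift_curve[OF \<gamma>(1) z] obtain c where
      c: "c \<in> curves_through euclidean_atlas (unit_cone S) z" "velocity proj_atlas (line \<circ> c) = v"
      unfolding \<gamma>(2) .
    have "v = projected z (vector_derivative c (at 0))" using project[OF c(1)] c(2) by simp
    then show "v \<in> projected z ` tangent_vectors (unit_cone S) z"
      unfolding tangent_vectors_def using c(1) by blast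
  next
    fix v assume "v \<in> projected z ` tangent_vectors (unit_cone S) z"
    then obtain c where c: "c \<in> curves_through euclidean_atlas (unit_cone S) z"
        "v = projected z (vector_derivative c (at 0))"
      unfolding tangent_vectors_def by blast
    have c': "smooth UNIV c" "c 0 = z" "\<And>t. c t \<in> unit_cone S"
      using c(1) by (auto simp: curves_through_euclidean_iff)
    have "c t \<noteq> 0" for t using c'(3)[of t] by auto
    then have "smooth_map euclidean_atlas proj_atlas (line \<circ> c)"
      by (rule smooth_map_line_compose[OF c'(1)])
    then have "line \<circ> c \<in> curves_through proj_atlas S (line z)"
      using c' by (auto simp: curves_through_def)
    then show "v \<in> tangent_space proj_atlas S (line z)"
      unfolding tangent_space_def c(2) project[OF c(1), symmetric] by (rule imageI)
  }
qed

section \<open>The symplectic forms\<close>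

text \<open>This is the Kaehler relation between form, complex structure and metric. Isotropy
  thereby becomes a statement about real inner products.\<close>

lemma std_form_eq_inner:
  fixes a b :: "complex ^ 'n::finite"
  shows "std_form q (directional p a) (directional p b) = (\<i> *s a) \<bullet> b"
  unfolding std_form_directional
  by (simp add: inner_vec_def inner_complex_def algebra_simps)

text \<open>Polarization: norms determine the inner product, and unit scalars preserve
  norms.\<close>

lemma inner_scale_unit:
  fixes a b :: "complex ^ 'n::finite"
  assumes "norm u = 1"
  shows "(u *s a) \<bullet> (u *s b) = a \<bullet> b"
proof -
  have "norm (u *s a + u *s b) = norm (a + b)"
    by (metis assms norm_vector_scalar_mult vector_add_ldistrib mult_1)
  then show ?thesis
    using assms by (simp add: dot_norm norm_vector_scalar_mult)
qed

lemma inner_vector_i_self: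
  fixes a :: "complex ^ 'n::finite"
  shows "(\<i> *s a) \<bullet> a = 0" "a \<bullet> (\<i> *s a) = 0"
  by (simp_all add: inner_vec_def inner_complex_def algebra_simps)

lemma vector_scalar_mult_of_real: "of_real r *s (x :: complex ^ 'n) = r *\<^sub>R x"
  using vector_scalar_mult_scaleR[of 1 r x] by simp

lemma tangent_vectors_mono: "S \<subseteq> T \<Longrightarrow> tangent_vectors S p \<subseteq> tangent_vectors T p"
  unfolding tangent_vectors_def by (auto simp: curves_through_def)

lemma tangent_vectorsI:
  assumes "smooth UNIV c" "c 0 = p" "range c \<subseteq> S" "(c has_vector_derivative a) (at 0)"
  shows "a \<in> tangent_vectors S p"
proof -
  have "vector_derivative c (at 0) = a" by (rule vector_derivative_at[OF assms(4)])
  then show ?thesis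
    unfolding tangent_vectors_def using assms by (auto simp: curves_through_euclidean_iff)
qed

lemma tangent_vectorsE:
  assumes "a \<in> tangent_vectors S p"
  obtains c where "c \<in> curves_through euclidean_atlas S p" "(c has_vector_derivative a) (at 0)"
  using assms curve_has_vector_derivative unfolding tangent_vectors_def by blast

lemma tangent_vectors_sphere_orthogonal:
  assumes "a \<in> tangent_vectors (sphere 0 1) z"
  shows "z \<bullet> a = 0"
proof -
  from tangent_vectorsE[OF assms] obtain c
    where c: "c \<in> curves_through euclidean_atlas (sphere 0 1) z" "(c has_vector_derivative a) (at 0)" .
  have c': "c 0 = z" "norm (c t) = 1" for t
    using c(1) by (auto simp: curves_through_def image_subset_iff)
  have "((\<lambda>t. c t \<bullet> c t) has_vector_derivative (c 0 \<bullet> a + a \<bullet> c 0)) (at 0)"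
    by (rule bounded_bilinear.has_vector_derivative[OF bounded_bilinear_inner c(2) c(2)])
  moreover have "(\<lambda>t. c t \<bullet> c t) = (\<lambda>t. 1)"
    by (simp add: dot_square_norm c'(2))
  ultimately have "((\<lambda>t. 1) has_vector_derivative 2 * (z \<bullet> a)) (at (0::real))"
    by (simp add: c'(1) inner_commute)
  from vector_derivative_unique_at[OF this has_vector_derivative_const] show ?thesis by simp
qed

text \<open>A straight line from z in an orthogonal direction leaves the sphere only to second
  order, so dividing it by its norm does not change its velocity at z.\<close>

lemma tangent_vectors_sphere:
  assumes "norm z = 1"
  shows "tangent_vectors (sphere 0 1) z = {a. z \<bullet> a = 0}"
proof (intro equalityI subsetI)
  fix a assume "a \<in> {a. z \<bullet> a = 0}"
  then have a: "z \<bullet> a = 0" by simp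
  define k where "k = norm a"
  define c where "c t = inverse (norm (z + t *\<^sub>R a)) *\<^sub>R (z + t *\<^sub>R a)" for t
  have norm2: "(norm (z + t *\<^sub>R a))\<^sup>2 = 1 + t\<^sup>2 * k\<^sup>2" for t
    using a assms by (simp add: norm_add_Pythagorean orthogonal_def k_def power_mult_distrib)
  then have norm: "norm (z + t *\<^sub>R a) = sqrt (1 + t\<^sup>2 * k\<^sup>2)" for t
    by (simp add: real_sqrt_unique[symmetric])
  have nz: "z + t *\<^sub>R a \<noteq> 0" for t
  proof -
    have "0 < 1 + t\<^sup>2 * k\<^sup>2" by (intro add_pos_nonneg) simp_all
    then show ?thesis using norm2[of t] by (intro notI) simp
  qed
  show "a \<in> tangent_vectors (sphere 0 1) z"
  proof (rule tangent_vectorsI)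
    show "smooth UNIV c"
      unfolding c_def using nz
      by (intro smooth_normalize smooth_add smooth_const smooth_bounded_linear
          bounded_linear_scaleR_left) auto
    show "c 0 = z" using assms by (simp add: c_def)
    show "range c \<subseteq> sphere 0 1" using nz by (auto simp: c_def)
    have "((\<lambda>t. inverse (sqrt (1 + t\<^sup>2 * k\<^sup>2))) has_field_derivative 0) (at 0)"
      by (auto intro!: derivative_eq_intros)
    moreover have "((\<lambda>t. z + t *\<^sub>R a) has_vector_derivative a) (at 0)"
      by (auto intro!: derivative_eq_intros)
    ultimately have "((\<lambda>t. inverse (sqrt (1 + t\<^sup>2 * k\<^sup>2)) *\<^sub>R (z + t *\<^sub>R a)) has_vector_derivative
        inverse (sqrt (1 + 0\<^sup>2 * k\<^sup>2)) *\<^sub>R a + 0 *\<^sub>R (z + 0 *\<^sub>R a)) (at 0)"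
      by (rule has_vector_derivative_scaleR)
    then show "(c has_vector_derivative a) (at 0)"
      unfolding c_def norm by simp
  qed
qed (simp add: tangent_vectors_sphere_orthogonal)

lemma rotation_has_vector_derivative:
  "((\<lambda>t. cis t *s z) has_vector_derivative \<i> *s (z :: complex ^ 'n::finite)) (at 0)"
proof -
  have "(cis has_vector_derivative \<i>) (at 0)"
    using has_derivative_cis[OF has_derivative_ident, of 0 UNIV] by (simp add: has_vector_derivative_def)
  then show ?thesis
    by (rule bounded_linear.has_vector_derivative[OF bounded_linear_vector_scalar_mult_left])
qed

lemma projected_vertical:
  assumes "z \<noteq> 0"
  shows "projected z (\<i> *s z) = 0"
proof -
  have "projected z (\<i> *s z) = velocity proj_atlas (line \<circ> (\<lambda>t. cis t *s z))"
    using velocity_line_compose[OF rotation_has_vector_derivative, of z] assms by simp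
  also have "line \<circ> (\<lambda>t. cis t *s z) = (\<lambda>t. line z)"
    by (simp add: fun_eq_iff line_scale)
  also have "velocity proj_atlas (\<lambda>t. line z) = 0"
    by (simp add: velocity_def fun_eq_iff o_def)
  finally show ?thesis .
qed

lemma vertical_tangent_vector:
  fixes z :: "complex ^ 'n::finite"
  assumes "z \<in> unit_cone S"
  shows "\<i> *s z \<in> tangent_vectors (unit_cone S) z"
proof (rule tangent_vectorsI)
  show "smooth UNIV (\<lambda>t. cis t *s z)"
    by (rule smooth_linear_compose[OF bounded_linear_vector_scalar_mult_left smooth_cis])
  show "range (\<lambda>t. cis t *s z) \<subseteq> unit_cone S"
    using assms by (auto simp: norm_vector_scalar_mult line_scale)
  show "((\<lambda>t. cis t *s z) has_vector_derivative \<i> *s z) (at 0)"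
    by (rule rotation_has_vector_derivative)
qed simp

text \<open>By \<open>projected_eq_0_imp\<close> two preimages differ by a complex multiple of z;
  pairing with z shows that the coefficient is purely imaginary.\<close>

lemma projected_eq_imp:
  fixes z a b :: "complex ^ 'n::finite"
  assumes z: "norm z = 1" and orth: "z \<bullet> a = 0" "z \<bullet> b = 0"
    and eq: "projected z a = projected z b"
  shows "\<exists>s. a = b + s *\<^sub>R (\<i> *s z)"
proof -
  have nz: "z \<noteq> 0" using z by auto
  interpret p: Vector_Spaces.linear "(*\<^sub>R)" functional_scale "projected z"
    by (rule linear_projected[OF nz])
  have "projected z (a - b) = 0" using eq by (simp add: p.diff)
  then obtain c where c: "a - b = c *s z" using projected_eq_0_imp[OF nz] by blast
  have "c *s z = Re c *\<^sub>R z + Im c *\<^sub>R (\<i> *s z)"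
    by (simp add: vec_eq_iff complex_eq_iff)
  moreover have "Re c = 0"
    using orth c z unfolding calculation
    by (metis add.right_neutral inner_add_right inner_diff_right inner_scaleR_right
        inner_vector_i_self(2) mult.right_neutral mult_zero_right norm_eq_1 diff_zero)
  ultimately have "a = b + Im c *\<^sub>R (\<i> *s z)" using c by (simp add: algebra_simps)
  then show ?thesis ..
qed

text \<open>The description operator in \<open>reduced_form\<close> needs a unique value. Any other
  choice of data has a base point \<open>u *s z\<close> with a unit scalar u, and velocities that
  differ from \<open>u *s a\<close> and \<open>u *s b\<close> by vertical vectors; neither change
  affects the form.\<close>

lemma reduced_form_projected:
  fixes z a b :: "complex ^ 'n::finite"
  assumes z: "norm z = 1"
    and ab: "a \<in> tangent_vectors (sphere 0 1) z" "b \<in> tangent_vectors (sphere 0 1) z"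
  shows "reduced_form (line z) (projected z a) (projected z b) = (\<i> *s a) \<bullet> b"
  unfolding reduced_form_def
proof (rule the_equality)
  have nz: "z \<noteq> 0" using z by auto
  obtain c where c: "c \<in> curves_through euclidean_atlas (sphere 0 1) z" "(c has_vector_derivative a) (at 0)"
    using tangent_vectorsE[OF ab(1)] .
  obtain d where d: "d \<in> curves_through euclidean_atlas (sphere 0 1) z" "(d has_vector_derivative b) (at 0)"
    using tangent_vectorsE[OF ab(2)] .
  have 0: "c 0 = z" "d 0 = z" using c(1) d(1) by (simp_all add: curves_through_def)
  have "velocity proj_atlas (line \<circ> c) = projected z a" "velocity proj_atlas (line \<circ> d) = projected z b"
    using velocity_line_compose[OF c(2)] velocity_line_compose[OF d(2)] nz by (simp_all add: 0)
  moreover have "(\<i> *s a) \<bullet> b = std_form z (velocity euclidean_atlas c) (velocity euclidean_atlas d)"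
    using velocity_euclidean[OF c(2)] velocity_euclidean[OF d(2)] by (simp add: 0 std_form_eq_inner)
  ultimately show "\<exists>z' c d. c \<in> curves_through euclidean_atlas (sphere 0 1) z' \<and>
      d \<in> curves_through euclidean_atlas (sphere 0 1) z' \<and> line z' = line z \<and>
      velocity proj_atlas (line \<circ> c) = projected z a \<and> velocity proj_atlas (line \<circ> d) = projected z b \<and>
      (\<i> *s a) \<bullet> b = std_form z' (velocity euclidean_atlas c) (velocity euclidean_atlas d)"
    using c(1) d(1) by blast
next
  have nz: "z \<noteq> 0" using z by auto
  fix r
  assume "\<exists>z' c d. c \<in> curves_through euclidean_atlas (sphere 0 1) z' \<and>
      d \<in> curves_through euclidean_atlas (sphere 0 1) z' \<and> line z' = line z \<and>
      velocity proj_atlas (line \<circ> c) = projected z a \<and> velocity proj_atlas (line \<circ> d) = projected z b \<and>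
      r = std_form z' (velocity euclidean_atlas c) (velocity euclidean_atlas d)"
  then obtain z' c d where c: "c \<in> curves_through euclidean_atlas (sphere 0 1) z'"
      and d: "d \<in> curves_through euclidean_atlas (sphere 0 1) z'"
      and line: "line z' = line z"
      and vc: "velocity proj_atlas (line \<circ> c) = projected z a"
      and vd: "velocity proj_atlas (line \<circ> d) = projected z b"
      and r: "r = std_form z' (velocity euclidean_atlas c) (velocity euclidean_atlas d)"
    by blast
  have z': "norm z' = 1" using c by (auto simp: curves_through_def image_subset_iff)
  obtain u where u: "u \<noteq> 0" "z' = u *s z" using line line_eq_iff[OF nz] by blast
  have norm_u: "norm u = 1" using z z' by (simp add: u(2) norm_vector_scalar_mult)
  have lift: "\<exists>s. vector_derivative e (at 0) = u *s (x + s *\<^sub>R (\<i> *s z))"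
    if e: "e \<in> curves_through euclidean_atlas (sphere 0 1) z'"
      and ve: "velocity proj_atlas (line \<circ> e) = projected z x" and x: "z \<bullet> x = 0" for e x
  proof -
    \<comment> \<open>The velocity is rotated back to the base point z, where it can be compared
      with x.\<close>
    define y where "y = inverse u *s vector_derivative e (at 0)"
    have y: "vector_derivative e (at 0) = u *s y" using u(1) by (simp add: y_def)
    have "e 0 = z'" "z' \<noteq> 0" using e z' by (auto simp: curves_through_def)
    then have "projected z x = projected z' (u *s y)"
      using velocity_line_compose[OF curve_has_vector_derivative[OF e]] ve by (simp add: y)
    also have "\<dots> = projected z y" unfolding u(2) by (rule projected_scale[OF u(1) nz])
    finally have eq: "projected z y = projected z x" by simp
    have "z' \<bullet> (u *s y) = 0"
      unfolding y[symmetric]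
      by (rule tangent_vectors_sphere_orthogonal) (use e in \<open>simp add: tangent_vectors_def\<close>)
    then have "z \<bullet> y = 0" unfolding u(2) inner_scale_unit[OF norm_u] .
    from projected_eq_imp[OF z this x eq] y show ?thesis by auto
  qed
  have orth: "z \<bullet> a = 0" "z \<bullet> b = 0" using ab by (simp_all add: tangent_vectors_sphere_orthogonal)
  obtain s t where st: "vector_derivative c (at 0) = u *s (a + s *\<^sub>R (\<i> *s z))"
      "vector_derivative d (at 0) = u *s (b + t *\<^sub>R (\<i> *s z))"
    using lift[OF c vc orth(1)] lift[OF d vd orth(2)] by blast
  have comm: "\<i> *s (u *s x) = u *s (\<i> *s x)" for x :: "complex ^ 'n"
    by (simp add: mult.commute)
  have i: "\<i> *s (a + s *\<^sub>R (\<i> *s z)) = \<i> *s a - s *\<^sub>R z"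
    by (simp add: vec_eq_iff complex_eq_iff)
  have "r = (\<i> *s (u *s (a + s *\<^sub>R (\<i> *s z)))) \<bullet> (u *s (b + t *\<^sub>R (\<i> *s z)))"
    unfolding r velocity_euclidean_curve[OF c] velocity_euclidean_curve[OF d] std_form_eq_inner st ..
  also have "\<dots> = (\<i> *s a - s *\<^sub>R z) \<bullet> (b + t *\<^sub>R (\<i> *s z))"
    unfolding comm inner_scale_unit[OF norm_u] i ..
  \<comment> \<open>The cross terms pair z with b, \<open>\<i> *s a\<close> with
    \<open>\<i> *s z\<close>, and z with \<open>\<i> *s z\<close>. All vanish, the second because
    multiplication by \<open>\<i>\<close> is an isometry and z is orthogonal to a.\<close>
  also have "\<dots> = (\<i> *s a) \<bullet> b"
    using orth inner_scale_unit[of \<i> a z]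
    by (simp add: inner_add_right inner_diff_left inner_vector_i_self inner_commute[of a z])
  finally show "r = (\<i> *s a) \<bullet> b" .
qed

section \<open>Lagrangian submanifolds and reduction\<close>

text \<open>V is a mere set, so the count is made on a basis of its span, chosen inside V and
  containing \<open>\<i> *s z\<close>. Without that vector, which is sent to 0, the remaining basis
  spans a space on which the projection is injective.\<close>

lemma dim_projected:
  fixes z :: "complex ^ 'n::finite"
  assumes z: "norm z = 1" and V: "V \<subseteq> {a. z \<bullet> a = 0}" "\<i> *s z \<in> V"
  shows "dim V = Suc (functional.dim (projected z ` V))"
proof -
  have nz: "z \<noteq> 0" using z by auto
  interpret p: Vector_Spaces.linear "(*\<^sub>R)" functional_scale "projected z"
    by (rule linear_projected[OF nz])
  define k where "k = \<i> *s z"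
  have "k \<noteq> 0" using nz by (simp add: k_def)
  then have "independent {k}" by simp
  then obtain B where B: "{k} \<subseteq> B" "B \<subseteq> V" "independent B" "V \<subseteq> span B"
    using maximal_independent_subset_extend[of "{k}" V] V(2) unfolding k_def by auto
  have pk: "projected z k = 0" unfolding k_def by (rule projected_vertical[OF nz])
  define B' where "B' = B - {k}"
  have BB': "B = insert k B'" "k \<notin> B'" using B(1) by (auto simp: B'_def)
  have "finite B" using B(3) by (rule independent_imp_finite)
  have k_span: "k \<notin> span B'"
    using B(3) BB' by (simp add: independent_insert)
  have orth: "span B' \<subseteq> {a. z \<bullet> a = 0}"
    using B(2) V(1) BB' by (intro span_minimal subspace_hyperplane) auto
  have "inj_on (projected z) (span B')"
  proof (rule inj_onI)
    fix x y assume x: "x \<in> span B'" and y: "y \<in> span B'" and "projected z x = projected z y"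
    then obtain s where s: "x = y + s *\<^sub>R k"
      using projected_eq_imp[OF z] orth unfolding k_def by blast
    then have "s *\<^sub>R k \<in> span B'" using span_diff[OF x y] by simp
    then have "s = 0" using k_span span_scale[of "s *\<^sub>R k" B' "inverse s"] by (cases "s = 0") auto
    then show "x = y" using s by simp
  qed
  then have "functional.dim (projected z ` B') = dim B'"
    by (rule functional_pair.dim_image_eq[OF linear_projected[OF nz]])
  also have "dim B' = card B'"
    using B(3) BB' by (intro dim_eq_card_independent) (simp add: independent_insert)
  finally have 1: "functional.dim (projected z ` B') = card B'" .
  have "functional.span (projected z ` V) = functional.span (projected z ` B')"
  proof -
    have "span V = span B" using B(2,4) by (metis span_eq span_superset order_trans)
    then have "functional.span (projected z ` V) = functional.span (projected z ` B)"
      using p.span_image[of V] p.span_image[of B] by (simp add: span_raw_def)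
    then show ?thesis by (simp add: BB'(1) pk functional.span_insert_0)
  qed
  then have "functional.dim (projected z ` V) = card B'"
    using 1 functional.dim_span by metis
  moreover have "dim V = card B" using B by (metis basis_card_eq_dim)
  ultimately show ?thesis using \<open>finite B\<close> BB' by simp
qed

lemma tangent_vectors_UNIV: "tangent_vectors UNIV p = (UNIV :: 'a::euclidean_space set)"
proof -
  have "a \<in> tangent_vectors UNIV p" for a :: 'a
  proof (rule tangent_vectorsI)
    show "smooth UNIV (\<lambda>t. p + t *\<^sub>R a)"
      by (intro smooth_add smooth_const smooth_bounded_linear bounded_linear_scaleR_left) auto
    show "((\<lambda>t. p + t *\<^sub>R a) has_vector_derivative a) (at 0)"
      by (auto intro!: derivative_eq_intros)
  qed auto
  then show ?thesis by blast
qed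

lemma lagrangian_euclidean_iff:
  fixes S :: "(complex ^ 'n::finite) set"
  shows "lagrangian euclidean_atlas std_form S \<longleftrightarrow>
    (\<forall>p\<in>S. 2 * dim (tangent_vectors S p) = DIM(complex ^ 'n) \<and>
      (\<forall>a\<in>tangent_vectors S p. \<forall>b\<in>tangent_vectors S p. (\<i> *s a) \<bullet> b = 0))"
  by (simp add: lagrangian_def tangent_space_euclidean dim_directional std_form_eq_inner
      tangent_vectors_UNIV del: DIM_cart)

text \<open>Scaling carries curves to curves, which gives one inclusion; the other is the same
  inclusion for \<open>inverse r\<close> and the scaled set.\<close>

lemma tangent_vectors_scaleR:
  assumes "r \<noteq> 0"
  shows "tangent_vectors ((*\<^sub>R) r ` S) (r *\<^sub>R p) = (*\<^sub>R) r ` tangent_vectors S p"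
proof -
  have *: "(*\<^sub>R) r ` tangent_vectors S p \<subseteq> tangent_vectors ((*\<^sub>R) r ` S) (r *\<^sub>R p)" for r S and p :: 'a
  proof
    fix a assume "a \<in> (*\<^sub>R) r ` tangent_vectors S p"
    then obtain c b where c: "c \<in> curves_through euclidean_atlas S p"
        "(c has_vector_derivative b) (at 0)" "a = r *\<^sub>R b"
      using tangent_vectorsE by blast
    have c': "smooth UNIV c" "c 0 = p" "range c \<subseteq> S"
      using c(1) by (auto simp: curves_through_euclidean_iff)
    show "a \<in> tangent_vectors ((*\<^sub>R) r ` S) (r *\<^sub>R p)"
    proof (rule tangent_vectorsI)
      show "smooth UNIV (\<lambda>t. r *\<^sub>R c t)"
        by (rule smooth_linear_compose[OF bounded_linear_scaleR_right c'(1)])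
      show "((\<lambda>t. r *\<^sub>R c t) has_vector_derivative a) (at 0)"
        unfolding c(3) by (rule bounded_linear.has_vector_derivative[OF bounded_linear_scaleR_right c(2)])
    qed (use c' in auto)
  qed
  have "tangent_vectors ((*\<^sub>R) r ` S) (r *\<^sub>R p) \<subseteq> (*\<^sub>R) r ` tangent_vectors S p"
  proof
    fix a assume a: "a \<in> tangent_vectors ((*\<^sub>R) r ` S) (r *\<^sub>R p)"
    have "inverse r *\<^sub>R a \<in> tangent_vectors ((*\<^sub>R) (inverse r) ` (*\<^sub>R) r ` S) (inverse r *\<^sub>R r *\<^sub>R p)"
      using *[of "inverse r" "(*\<^sub>R) r ` S" "r *\<^sub>R p"] a by blast
    then have "inverse r *\<^sub>R a \<in> tangent_vectors S p"
      using assms by (simp add: image_image)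
    moreover have "a = r *\<^sub>R inverse r *\<^sub>R a" using assms by simp
    ultimately show "a \<in> (*\<^sub>R) r ` tangent_vectors S p" by (rule rev_image_eqI)
  qed
  then show ?thesis using *[of r S p] by (rule subset_antisym)
qed

text \<open>The form is multiplied by the square of r and dimensions are unchanged. This moves an
  orbit on a sphere of any positive radius to the unit sphere.\<close>

lemma lagrangian_scaleR:
  fixes S :: "(complex ^ 'n::finite) set"
  assumes r: "r \<noteq> 0"
  shows "lagrangian euclidean_atlas std_form ((*\<^sub>R) r ` S) \<longleftrightarrow> lagrangian euclidean_atlas std_form S"
proof -
  have "dim ((*\<^sub>R) r ` V) = dim V" for V :: "(complex ^ 'n) set"
    by (rule dim_image_eq) (use r in \<open>auto simp: inj_on_def\<close>)
  moreover have "(\<i> *s (r *\<^sub>R a)) \<bullet> (r *\<^sub>R b) = r * (r * ((\<i> *s a) \<bullet> b))" for a b :: "complex ^ 'n"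
  proof -
    have "\<i> *s (r *\<^sub>R a) = r *\<^sub>R (\<i> *s a)" by (simp add: vec_eq_iff)
    then show ?thesis by simp
  qed
  ultimately show ?thesis
    unfolding lagrangian_euclidean_iff using r by (simp add: tangent_vectors_scaleR del: DIM_cart)
qed

lemma lagrangian_unit_cone_iff:
  fixes S :: "(complex ^ 'n::finite) set set"
  assumes S: "S \<subseteq> points proj_atlas"
  shows "lagrangian proj_atlas reduced_form S \<longleftrightarrow> lagrangian euclidean_atlas std_form (unit_cone S)"
proof -
  define P where "P L \<longleftrightarrow> 2 * functional.dim (tangent_space proj_atlas S L) =
      functional.dim (tangent_space proj_atlas (points proj_atlas) L) \<and>
      (\<forall>v\<in>tangent_space proj_atlas S L. \<forall>w\<in>tangent_space proj_atlas S L. reduced_form L v w = 0)" for L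
  define Q where "Q z \<longleftrightarrow> 2 * dim (tangent_vectors (unit_cone S) z) = DIM(complex ^ 'n) \<and>
      (\<forall>a\<in>tangent_vectors (unit_cone S) z. \<forall>b\<in>tangent_vectors (unit_cone S) z. (\<i> *s a) \<bullet> b = 0)" for z
  have PQ: "P (line z) \<longleftrightarrow> Q z" if z: "z \<in> unit_cone S" for z
  proof -
    have "norm z = 1" using z by simp
    then have nz: "norm z = 1" "z \<noteq> 0" by auto
    let ?V = "tangent_vectors (unit_cone S) z" and ?W = "{a. z \<bullet> a = 0}"
    \<comment> \<open>The ambient tangent space is the special case where S consists of all points;
      its cone is the whole sphere.\<close>
    have "unit_cone (points proj_atlas) = (sphere 0 1 :: (complex ^ 'n) set)"
    proof -
      have "\<forall>w\<in>sphere 0 1. line w \<in> points proj_atlas"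
        unfolding points_proj_atlas by (intro ballI imageI) auto
      then show ?thesis by blast
    qed
    then have W: "tangent_vectors (unit_cone (points proj_atlas)) z = ?W"
      by (simp add: tangent_vectors_sphere nz)
    have V: "?V \<subseteq> tangent_vectors (sphere 0 1) z"
      by (rule tangent_vectors_mono) auto
    then have VW: "?V \<subseteq> ?W" by (simp add: tangent_vectors_sphere nz)
    have "dim ?V = Suc (functional.dim (projected z ` ?V))"
      by (rule dim_projected[OF nz(1) VW vertical_tangent_vector[OF z]])
    moreover have "dim ?W = Suc (functional.dim (projected z ` ?W))"
      by (rule dim_projected[OF nz(1) order_refl]) (simp add: inner_vector_i_self)
    \<comment> \<open>The hyperplane has one dimension less than the ambient space and loses another
      under projection. With d the dimension of the projected tangent vectors of S, both conditions
      say \<open>2 * d + 2 = DIM(complex ^ 'n)\<close>.\<close>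
    moreover have "dim ?W = DIM(complex ^ 'n) - 1" by (rule dim_hyperplane[OF nz(2)])
    moreover have "reduced_form (line z) (projected z a) (projected z b) = (\<i> *s a) \<bullet> b"
      if "a \<in> ?V" "b \<in> ?V" for a b
      using reduced_form_projected[OF nz(1)] V that by blast
    ultimately show ?thesis
      unfolding P_def Q_def tangent_space_proj[OF nz(1)] W by auto
  qed
  \<comment> \<open>The degenerate line of the zero vector has no unit representative; the inclusion
    of S in the projective space rules it out.\<close>
  have "S = line ` unit_cone S"
  proof (intro equalityI subsetI)
    fix L assume L: "L \<in> S"
    then obtain z where z: "z \<noteq> 0" "L = line z" using S by (auto simp: points_proj_atlas)
    let ?u = "of_real (inverse (norm z)) *s z"
    have "line ?u = L" using z by (simp add: line_scale)
    moreover have "norm ?u = 1" using z by (simp add: norm_vector_scalar_mult norm_inverse)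
    ultimately show "L \<in> line ` unit_cone S"
      using L by (intro image_eqI[of _ _ ?u]) auto
  qed auto
  then have "(\<forall>L\<in>S. P L) \<longleftrightarrow> (\<forall>z\<in>unit_cone S. P (line z))" by (metis (no_types, lifting) image_iff)
  moreover have "lagrangian proj_atlas reduced_form S \<longleftrightarrow> (\<forall>L\<in>S. P L)"
    unfolding P_def by (rule lagrangian_def)
  moreover have "lagrangian euclidean_atlas std_form (unit_cone S) \<longleftrightarrow> (\<forall>z\<in>unit_cone S. Q z)"
    unfolding Q_def by (rule lagrangian_euclidean_iff)
  ultimately show ?thesis using PQ by simp
qed

section \<open>Symplectic maps commuting with the circle, and orbits of the product group\<close>

lemma pushforward_directional:
  fixes g :: "'a::euclidean_space \<Rightarrow> 'a"
  assumes "smooth UNIV g"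
  shows "pushforward euclidean_atlas g (directional p a) =
    directional (g p) (frechet_derivative g (at p) a)"
proof
  fix f :: "'a \<Rightarrow> real"
  show "pushforward euclidean_atlas g (directional p a) f =
    directional (g p) (frechet_derivative g (at p) a) f"
  proof (cases "smooth UNIV f")
    case True
    have "((f \<circ> g) has_derivative (\<lambda>b. frechet_derivative f (at (g p)) (frechet_derivative g (at p) b))) (at p)"
      using has_derivative_compose[OF smooth_has_derivative[OF assms, of p] smooth_has_derivative[OF True, of "g p"]]
      by (simp add: o_def)
    note * = fun_cong[OF frechet_derivative_at[OF this], of a, symmetric]
    have "smooth UNIV (f \<circ> g)" using smooth_compose[OF assms True] by (simp add: o_def)
    then show ?thesis
      using True * by (simp add: pushforward_def directional_def smooth_functions_euclidean_iff)
  qed (simp add: pushforward_def directional_def smooth_functions_euclidean_iff)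
qed

text \<open>The function \<open>(norm z)\<^sup>2 / 2\<close> is, up to sign, the moment map of the circle action. Its differential
  is determined by the symplectic form and the generator of the action, both of which are preserved.\<close>

lemma equivariant_symplectic_diffeo_norm:
  fixes g :: "complex ^ 'n::finite \<Rightarrow> complex ^ 'n"
  assumes g: "symplectic_diffeo euclidean_atlas std_form g"
    and equivariant: "\<And>u z. norm u = 1 \<Longrightarrow> g (u *s z) = u *s g z"
  shows "norm (g z) = norm z"
proof -
  have smooth: "smooth UNIV g"
    using g by (simp add: symplectic_diffeo_def smooth_map_euclidean_iff)
  let ?g' = "\<lambda>p. frechet_derivative g (at p)"
  have g': "(g has_derivative ?g' p) (at p)" for p
    using smooth_has_derivative[OF smooth] by simp
  have symplectic: "(\<i> *s ?g' p a) \<bullet> ?g' p b = (\<i> *s a) \<bullet> b" for p a b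
  proof -
    have "directional p a \<in> tangent_space euclidean_atlas (points euclidean_atlas) p" for a
      by (simp add: tangent_space_euclidean tangent_vectors_UNIV)
    then have "std_form (g p) (pushforward euclidean_atlas g (directional p a))
        (pushforward euclidean_atlas g (directional p b)) = std_form p (directional p a) (directional p b)"
      using g unfolding symplectic_diffeo_def by simp
    then show ?thesis by (simp add: pushforward_directional[OF smooth] std_form_eq_inner)
  qed
  \<comment> \<open>Differentiate \<open>g (cis t *s p) = cis t *s g p\<close> at t = 0.\<close>
  have generator: "?g' p (\<i> *s p) = \<i> *s g p" for p
  proof -
    have "((\<lambda>t. g (cis t *s p)) has_vector_derivative ?g' (cis 0 *s p) (\<i> *s p)) (at 0)"
      using vector_derivative_diff_chain_within[OF rotation_has_vector_derivative
          has_derivative_at_withinI[OF g'], of p] by (simp add: o_def)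
    then have "((\<lambda>t. cis t *s g p) has_vector_derivative ?g' p (\<i> *s p)) (at 0)"
      by (simp add: equivariant)
    from vector_derivative_unique_at[OF this rotation_has_vector_derivative] show ?thesis .
  qed
  have minus: "\<i> *s (\<i> *s x) = - x" for x :: "complex ^ 'n"
    by (simp add: vec_eq_iff)
  have "((\<lambda>p. g p \<bullet> g p - p \<bullet> p) has_derivative (\<lambda>b. 0)) (at p)" for p
  proof -
    \<comment> \<open>Symplecticity is applied to \<open>\<i> *s p\<close> and b. The former is
      mapped to \<open>\<i> *s g p\<close>, and the second factor \<open>\<i>\<close> in the form
      leaves only a sign on both sides.\<close>
    have "g p \<bullet> ?g' p b = p \<bullet> b" for b
      using symplectic[of p "\<i> *s p" b] by (simp add: generator minus)
    then show ?thesis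
      by (auto intro!: derivative_eq_intros g' simp: inner_commute)
  qed
  then obtain k where k: "\<And>p. g p \<bullet> g p - p \<bullet> p = k"
    using has_derivative_zero_constant[of UNIV "\<lambda>p. g p \<bullet> g p - p \<bullet> p"] by auto
  \<comment> \<open>Commuting with -1 fixes the origin, where the constant k is evaluated.\<close>
  have "g 0 = - g 0" using equivariant[of "-1" 0] by simp
  then have "2 *\<^sub>R g 0 = 0" by (metis scaleR_2 add.right_inverse)
  then have "g 0 = 0" by simp
  then have "g z \<bullet> g z = z \<bullet> z" using k[of 0] k[of z] by simp
  then show ?thesis by (simp add: norm_eq_sqrt_inner)
qed

text \<open>Nonzero vectors of equal norm on the same line differ by a unit scalar, which the circle
  factor supplies. So membership in the product orbit depends only on the norm and the line of a
  vector.\<close>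

lemma orbit_circle_product:
  fixes \<Phi> :: "'k \<Rightarrow> complex ^ 'n::finite \<Rightarrow> complex ^ 'n"
  assumes "lifts_projective_action K \<phi> \<Phi>" "z \<noteq> 0"
    and norm: "\<And>k z. k \<in> carrier K \<Longrightarrow> norm (\<Phi> k z) = norm z"
  shows "orbit (circle_group \<times>\<times> K) (circle_product_action \<Phi>) z =
    (*\<^sub>R) (norm z) ` unit_cone (orbit K \<phi> (line z))"
proof -
  have line: "line (\<Phi> k z) = \<phi> k (line z)" if "k \<in> carrier K" for k
    using assms(1,2) that by (simp add: lifts_projective_action_def)
  have nz: "\<Phi> k z \<noteq> 0" if "k \<in> carrier K" for k
    using norm[OF that, of z] assms(2) by auto
  have line_scaleR: "line (r *\<^sub>R w) = line w" if "r \<noteq> 0" for r and w :: "complex ^ 'n"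
    using line_scale[of "of_real r" w] that by (simp add: vector_scalar_mult_of_real)
  show ?thesis
  proof (intro equalityI subsetI)
    fix w assume "w \<in> orbit (circle_group \<times>\<times> K) (circle_product_action \<Phi>) z"
    then obtain u k where uk: "norm u = 1" "k \<in> carrier K" "w = u *s \<Phi> k z"
      by (auto simp: orbit_def DirProd_def circle_group_def circle_product_action_def)
    then have "u \<noteq> 0" by auto
    have "line w = \<phi> k (line z)" using \<open>u \<noteq> 0\<close> uk by (simp add: line_scale line)
    moreover have "norm w = norm z" using uk by (simp add: norm_vector_scalar_mult norm)
    ultimately have "inverse (norm z) *\<^sub>R w \<in> unit_cone (orbit K \<phi> (line z))"
      using uk(2) assms(2) by (auto simp: orbit_def line_scaleR)
    moreover have "w = norm z *\<^sub>R inverse (norm z) *\<^sub>R w" using assms(2) by simp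
    ultimately show "w \<in> (*\<^sub>R) (norm z) ` unit_cone (orbit K \<phi> (line z))"
      by (rule rev_image_eqI)
  next
    fix w assume "w \<in> (*\<^sub>R) (norm z) ` unit_cone (orbit K \<phi> (line z))"
    then obtain v k where v: "w = norm z *\<^sub>R v" "norm v = 1" "k \<in> carrier K" "line v = \<phi> k (line z)"
      by (auto simp: orbit_def)
    have "line w = line (\<Phi> k z)" using v assms(2) by (simp add: line_scaleR line)
    then obtain u where u: "w = u *s \<Phi> k z" using line_eq_iff[OF nz[OF v(3)]] by blast
    have "norm w = norm z" using v by simp
    then have "norm u = 1" using assms(2) norm[OF v(3), of z] by (simp add: u norm_vector_scalar_mult)
    then show "w \<in> orbit (circle_group \<times>\<times> K) (circle_product_action \<Phi>) z"
      using u v(3) by (auto simp: orbit_def DirProd_def circle_group_def circle_product_action_def)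
  qed
qed

text \<open>Constant curves have velocity 0, whereas half the ambient dimension is positive. This
  disposes of the orbit of the origin.\<close>

lemma not_lagrangian_singleton:
  "\<not> lagrangian euclidean_atlas std_form {p :: complex ^ 'n::finite}"
proof -
  have "tangent_vectors {p} p \<subseteq> {0}"
  proof
    fix a assume "a \<in> tangent_vectors {p} p"
    then obtain c where c: "c \<in> curves_through euclidean_atlas {p} p" "(c has_vector_derivative a) (at 0)"
      by (rule tangent_vectorsE)
    then have "c = (\<lambda>t. p)" by (auto simp: curves_through_def)
    from vector_derivative_unique_at[OF c(2)[unfolded this] has_vector_derivative_const]
    show "a \<in> {0}" by simp
  qed
  then have "dim (tangent_vectors {p} p) = 0" by (simp only: dim_eq_0)
  then show ?thesis by (simp add: lagrangian_euclidean_iff del: dim_eq_0)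
qed

theorem corollary3p3:
  fixes K :: "('k, 'x) monoid_scheme"
    and A :: "('k, 'b::euclidean_space) atlas"
    and \<phi> :: "'k \<Rightarrow> (complex ^ 'n) set \<Rightarrow> (complex ^ 'n) set"
    and \<Phi> :: "'k \<Rightarrow> complex ^ 'n \<Rightarrow> complex ^ 'n"
  assumes "semisimple_lie_group K A"
    and "compact_space (atlas_topology A)"
    and "hamiltonian_action K A proj_atlas reduced_form \<phi>"
    and "hamiltonian_action K A euclidean_atlas std_form \<Phi>"
    and "lifts_projective_action K \<phi> \<Phi>"
  shows "(\<exists>L\<in>points proj_atlas. lagrangian proj_atlas reduced_form (orbit K \<phi> L)) \<longleftrightarrow>
         (\<exists>z. lagrangian euclidean_atlas std_form
                (orbit (circle_group \<times>\<times> K) (circle_product_action \<Phi>) z))"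
proof -
  \<comment> \<open>Each \<open>\<Phi> k\<close> is symplectic because the lifted action is
    Hamiltonian, and it commutes with unit scalars by the lifting property.\<close>
  have norm: "norm (\<Phi> k z) = norm z" if "k \<in> carrier K" for k z
    using assms(4,5) that
    by (intro equivariant_symplectic_diffeo_norm)
      (auto simp: hamiltonian_action_def lifts_projective_action_def circle_group_def)
  have "orbit K \<phi> (line z) \<subseteq> points proj_atlas" if "z \<noteq> 0" for z
  proof
    fix L assume "L \<in> orbit K \<phi> (line z)"
    then obtain k where "k \<in> carrier K" "L = \<phi> k (line z)"
      by (auto simp: orbit_def)
    then have k: "k \<in> carrier K" "L = line (\<Phi> k z)"
      using assms(5) that by (auto simp: lifts_projective_action_def)
    \<comment> \<open>Norm preservation keeps the image vector away from 0, so its line is a genuine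
      point.\<close>
    then have "\<Phi> k z \<noteq> 0" using norm[OF k(1), of z] that by auto
    then show "L \<in> points proj_atlas" using k(2) by (simp add: points_proj_atlas)
  qed
  then have iff: "lagrangian proj_atlas reduced_form (orbit K \<phi> (line z)) \<longleftrightarrow>
      lagrangian euclidean_atlas std_form (orbit (circle_group \<times>\<times> K) (circle_product_action \<Phi>) z)"
    if "z \<noteq> 0" for z
    using that orbit_circle_product[OF assms(5) that norm]
    by (simp add: lagrangian_unit_cone_iff lagrangian_scaleR)
  \<comment> \<open>The existential over z also admits z = 0, for which there is no point below;
    norm preservation makes its orbit the single point 0.\<close>
  have "\<not> lagrangian euclidean_atlas std_form
      (orbit (circle_group \<times>\<times> K) (circle_product_action \<Phi>) 0)"
  proof -
    have "group K" using assms(1) by (simp add: semisimple_lie_group_def lie_group_def)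
    then have one: "\<one>\<^bsub>K\<^esub> \<in> carrier K" by (intro monoid.one_closed group.is_monoid)
    have zero: "\<Phi> k 0 = 0" if "k \<in> carrier K" for k using norm[OF that, of 0] by simp
    have act: "circle_product_action \<Phi> g 0 = 0" if "g \<in> carrier (circle_group \<times>\<times> K)" for g
      using that zero by (auto simp: DirProd_def circle_product_action_def)
    have one': "(1, \<one>\<^bsub>K\<^esub>) \<in> carrier (circle_group \<times>\<times> K)"
      using one by (simp add: DirProd_def circle_group_def)
    have "orbit (circle_group \<times>\<times> K) (circle_product_action \<Phi>) 0 =
        (\<lambda>g. circle_product_action \<Phi> g 0) ` carrier (circle_group \<times>\<times> K)"
      unfolding orbit_def by (rule Setcompr_eq_image)
    also have "\<dots> = (\<lambda>g. 0) ` carrier (circle_group \<times>\<times> K)"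
      by (rule image_cong[OF refl act])
    also have "\<dots> = {0}" by (rule image_constant[OF one'])
    finally show ?thesis by (simp add: not_lagrangian_singleton)
  qed
  then have nz: "z \<noteq> 0" if "lagrangian euclidean_atlas std_form
      (orbit (circle_group \<times>\<times> K) (circle_product_action \<Phi>) z)" for z
    using that by blast
  show ?thesis
    unfolding points_proj_atlas
  proof (intro iffI)
    assume "\<exists>L\<in>line ` (- {0}). lagrangian proj_atlas reduced_form (orbit K \<phi> L)"
    then obtain z where "z \<noteq> 0" "lagrangian proj_atlas reduced_form (orbit K \<phi> (line z))" by auto
    then show "\<exists>z. lagrangian euclidean_atlas std_form
        (orbit (circle_group \<times>\<times> K) (circle_product_action \<Phi>) z)"
      using iff by blast
  next
    assume "\<exists>z. lagrangian euclidean_atlas std_form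
        (orbit (circle_group \<times>\<times> K) (circle_product_action \<Phi>) z)"
    then obtain z where z: "lagrangian euclidean_atlas std_form
        (orbit (circle_group \<times>\<times> K) (circle_product_action \<Phi>) z)" ..
    then have "lagrangian proj_atlas reduced_form (orbit K \<phi> (line z))" using iff[OF nz[OF z]] by simp
    then show "\<exists>L\<in>line ` (- {0}). lagrangian proj_atlas reduced_form (orbit K \<phi> L)"
      using nz[OF z] by blast
  qed
qed

end
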